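(* Let $(\mathcal{R},g)$ be an oriented, connected, smooth Riemannian 3-manifold with (possibly empty) boundary. Suppose that there exist two smooth vector fields $\boldsymbol{Y}_1,\boldsymbol{Y}_2$ on $\mathcal{R}$, satisfying the Killing equations, and a constant $\lambda\in\mathbb{R}$ with $\mathrm{curl}(\boldsymbol{Y}_i)=\lambda\boldsymbol{Y}_i$ for $i=1,2$. If $\boldsymbol{Y}_1(p)\times\boldsymbol{Y}_2(p)\neq 0$ at some point $p\in\mathcal{R}$, then $(\mathcal{R},g)$ is of constant sectional curvature $c=\frac{\lambda^2}{4}$.
   Context: For a smooth vector field $\boldsymbol{X}$ let $\omega^1_{\boldsymbol{X}}=g(\boldsymbol{X},\cdot)$; $\mathrm{curl}(\boldsymbol{X})$ is defined by $\omega^1_{\mathrm{curl}(\boldsymbol{X})}=\star d\omega^1_{\boldsymbol{X}}$, where $\star$ is the Hodge star and $d$ the exterior derivative. $\times$ is the cross product on tangent spaces induced by the metric and orientation; $\boldsymbol{Y}_1(p)\times\boldsymbol{Y}_2(p)\neq0$ means that the two vectors are linearly independent. *)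

theory Defs
  imports "HOL-Analysis.Analysis"
begin

section \<open>Smooth maps on subsets of Euclidean space\<close>

text \<open>
  Directional derivative of \<open>f\<close> within \<open>S\<close>. It is only used for \<open>S\<close> relatively open in a
  closed half-space, where the derivative within \<open>S\<close> is unique, also at boundary points.
\<close>
definition dir_deriv ::
  "'a::real_normed_vector set \<Rightarrow> ('a \<Rightarrow> 'b::real_normed_vector) \<Rightarrow> 'a \<Rightarrow> 'a \<Rightarrow> 'b" where
  "dir_deriv S f u x = frechet_derivative f (at x within S) u"

primrec Ck_on_open ::
  "nat \<Rightarrow> 'a::real_normed_vector set \<Rightarrow> ('a \<Rightarrow> 'b::real_normed_vector) \<Rightarrow> bool" where
  "Ck_on_open 0 U f \<longleftrightarrow> continuous_on U f"
| "Ck_on_open (Suc k) U f \<longleftrightarrow>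
     (\<forall>x\<in>U. f differentiable (at x)) \<and>
     (\<forall>u. Ck_on_open k U (\<lambda>x. frechet_derivative f (at x) u))"

text \<open>On a set that need not be open, smooth means: locally the restriction of a smooth map.\<close>
definition smooth_on ::
  "'a::real_normed_vector set \<Rightarrow> ('a \<Rightarrow> 'b::real_normed_vector) \<Rightarrow> bool" where
  "smooth_on S f \<longleftrightarrow>
     (\<forall>x\<in>S. \<exists>U F. open U \<and> x \<in> U \<and> (\<forall>k. Ck_on_open k U F) \<and> (\<forall>y\<in>S \<inter> U. F y = f y))"

section \<open>Oriented smooth 3-manifolds with boundary\<close>

datatype 'a chart = Chart (chart_dom: "'a set") (chart_map: "'a \<Rightarrow> real^3")

definition half_space :: "(real^3) set" where
  "half_space = {x. 0 \<le> x $ 3}"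

definition chart_image :: "'a chart \<Rightarrow> (real^3) set" where
  "chart_image c = chart_map c ` chart_dom c"

definition overlap :: "'a chart \<Rightarrow> 'a chart \<Rightarrow> (real^3) set" where
  "overlap c d = chart_map c ` (chart_dom c \<inter> chart_dom d)"

text \<open>Coordinate change from \<open>c\<close> to \<open>d\<close>; only meaningful on \<open>overlap c d\<close>.\<close>
definition transition :: "'a chart \<Rightarrow> 'a chart \<Rightarrow> real^3 \<Rightarrow> real^3" where
  "transition c d = chart_map d \<circ> inv_into (chart_dom c) (chart_map c)"

abbreviation transition_deriv :: "'a chart \<Rightarrow> 'a chart \<Rightarrow> real^3 \<Rightarrow> real^3 \<Rightarrow> real^3" where
  "transition_deriv c d x u \<equiv> dir_deriv (overlap c d) (transition c d) u x"

text \<open>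
  The smooth structure and the orientation are both given by an oriented atlas \<open>A\<close>: all
  charts of \<open>A\<close> are positively oriented. As charts take values in the closed half-space and
  need not meet its boundary, the boundary of the manifold may be empty.
\<close>
locale oriented_smooth_3_manifold =
  fixes M :: "'a topology" and A :: "'a chart set"
  assumes Hausdorff: "Hausdorff_space M"
    and second_countable: "second_countable M"
    and open_dom: "\<And>c. c \<in> A \<Longrightarrow> openin M (chart_dom c)"
    and cover: "(\<Union>c\<in>A. chart_dom c) = topspace M"
    and open_image: "\<And>c. c \<in> A \<Longrightarrow> openin (top_of_set half_space) (chart_image c)"
    and homeomorphic: "\<And>c. c \<in> A \<Longrightarrow>
      homeomorphic_map (subtopology M (chart_dom c)) (top_of_set (chart_image c)) (chart_map c)"
    and smooth_transition: "\<And>c d. c \<in> A \<Longrightarrow> d \<in> A \<Longrightarrow> smooth_on (overlap c d) (transition c d)"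
    and oriented: "\<And>c d x. c \<in> A \<Longrightarrow> d \<in> A \<Longrightarrow> x \<in> overlap c d \<Longrightarrow>
      det (matrix (transition_deriv c d x)) > 0"

section \<open>Vector fields and Riemannian metrics\<close>

text \<open>
  A tensor field is given by its components in every chart, as functions of the coordinates;
  only the values on \<open>chart_image c\<close> for charts \<open>c\<close> of the atlas matter.
\<close>
type_synonym 'a vfield = "'a chart \<Rightarrow> real^3 \<Rightarrow> real^3"
type_synonym 'a metric = "'a chart \<Rightarrow> real^3 \<Rightarrow> real^3^3"

definition smooth_vector_field :: "'a chart set \<Rightarrow> 'a vfield \<Rightarrow> bool" where
  "smooth_vector_field A X \<longleftrightarrow>
     (\<forall>c\<in>A. smooth_on (chart_image c) (X c)) \<and>
     (\<forall>c\<in>A. \<forall>d\<in>A. \<forall>x\<in>overlap c d. X d (transition c d x) = transition_deriv c d x (X c x))"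

definition vfield_eq :: "'a chart set \<Rightarrow> 'a vfield \<Rightarrow> 'a vfield \<Rightarrow> bool" where
  "vfield_eq A X Y \<longleftrightarrow> (\<forall>c\<in>A. \<forall>x\<in>chart_image c. X c x = Y c x)"

text \<open>A tangent vector at \<open>p\<close> is zero iff its components are zero in all charts around \<open>p\<close>.\<close>
definition zero_at :: "'a chart set \<Rightarrow> 'a vfield \<Rightarrow> 'a \<Rightarrow> bool" where
  "zero_at A X p \<longleftrightarrow> (\<forall>c\<in>A. p \<in> chart_dom c \<longrightarrow> X c (chart_map c p) = 0)"

text \<open>The bilinear form on \<open>real^3\<close> with Gram matrix \<open>G\<close>.\<close>
definition ip :: "real^3^3 \<Rightarrow> real^3 \<Rightarrow> real^3 \<Rightarrow> real" where
  "ip G u v = u \<bullet> (G *v v)"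

locale oriented_Riemannian_3_manifold = oriented_smooth_3_manifold M A
  for M :: "'a topology" and A :: "'a chart set" +
  fixes g :: "'a metric"
  assumes smooth_metric: "\<And>c. c \<in> A \<Longrightarrow> smooth_on (chart_image c) (g c)"
    and metric_transform: "\<And>c d x u v. c \<in> A \<Longrightarrow> d \<in> A \<Longrightarrow> x \<in> overlap c d \<Longrightarrow>
      ip (g d (transition c d x)) (transition_deriv c d x u) (transition_deriv c d x v)
        = ip (g c x) u v"
    and metric_sym: "\<And>c x u v. c \<in> A \<Longrightarrow> x \<in> chart_image c \<Longrightarrow> ip (g c x) u v = ip (g c x) v u"
    and metric_pos: "\<And>c x u. c \<in> A \<Longrightarrow> x \<in> chart_image c \<Longrightarrow> u \<noteq> 0 \<Longrightarrow> ip (g c x) u u > 0"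

section \<open>Linear algebra of an oriented inner product on \<open>real^3\<close>\<close>

text \<open>Components of the 1-form \<open>g(u, _)\<close>, and the inverse isomorphism.\<close>
definition flat :: "real^3^3 \<Rightarrow> real^3 \<Rightarrow> real^3" where
  "flat G u = (\<chi> j. ip G u (axis j 1))"

definition sharp :: "real^3^3 \<Rightarrow> real^3 \<Rightarrow> real^3" where
  "sharp G \<omega> = (THE u. flat G u = \<omega>)"

text \<open>The Riemannian volume form, in a positively oriented chart.\<close>
definition vol :: "real^3^3 \<Rightarrow> real^3 \<Rightarrow> real^3 \<Rightarrow> real^3 \<Rightarrow> real" where
  "vol G u v w = sqrt (det G) * det (vector [u, v, w] :: real^3^3)"

text \<open>The cross product is determined by \<open>g(u \<times> v, w) = vol(u, v, w)\<close>.\<close>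
definition cross :: "real^3^3 \<Rightarrow> real^3 \<Rightarrow> real^3 \<Rightarrow> real^3" where
  "cross G u v = sharp G (\<chi> k. vol G u v (axis k 1))"

text \<open>
  Hodge star of the 2-form with components \<open>\<beta> $ i $ j = \<beta>(e\<^sub>i, e\<^sub>j)\<close>: raise both indices of
  \<open>\<beta>\<close> and contract with the volume form. The factor 1/2 accounts for summing over all pairs
  \<open>(i, j)\<close> instead of \<open>i < j\<close>; equivalently, \<open>\<alpha> \<and> \<star>\<beta> = \<langle>\<alpha>, \<beta>\<rangle> vol\<close>.
\<close>
definition hodge_star2 :: "real^3^3 \<Rightarrow> real^3^3 \<Rightarrow> real^3" where
  "hodge_star2 G \<beta> =
     (let H = matrix_inv G; \<beta>' = H ** \<beta> ** transpose H in
      (\<chi> k. 1/2 * (\<Sum>i\<in>UNIV. \<Sum>j\<in>UNIV. \<beta>' $ i $ j * vol G (axis i 1) (axis j 1) (axis k 1))))"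

lemma flat_eq: "flat G u = transpose G *v u"
  by (simp add: flat_def ip_def vec_eq_iff matrix_vector_mult_def transpose_def inner_vec_def
      axis_def if_distrib if_distribR sum.delta mult.commute cong: if_cong)

lemma ip_flat: "ip G u v = flat G u \<bullet> v"
  by (simp add: flat_eq ip_def dot_lmul_matrix flip: vector_transpose_matrix)

lemma flat_sharp:
  assumes "\<And>u. u \<noteq> 0 \<Longrightarrow> ip G u u > 0"
  shows "flat G (sharp G \<omega>) = \<omega>"
proof -
  have lin: "linear (flat G)"
    unfolding flat_eq[abs_def] by simp
  have "u = 0" if "flat G u = 0" for u
    using assms[of u] that ip_flat[of G u u] by force
  then have inj: "inj (flat G)"
    by (simp add: linear_injective_0[OF lin])
  then have "surj (flat G)"
    using lin by (simp add: linear_injective_imp_surjective)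
  with inj have "\<exists>!u. flat G u = \<omega>"
    by (metis injD surjD)
  then show ?thesis
    unfolding sharp_def by (rule theI')
qed

section \<open>Curl\<close>

definition ext_deriv1 :: "(real^3) set \<Rightarrow> (real^3 \<Rightarrow> real^3) \<Rightarrow> real^3 \<Rightarrow> real^3^3" where
  "ext_deriv1 S \<omega> x =
     (\<chi> i j. dir_deriv S \<omega> (axis i 1) x $ j - dir_deriv S \<omega> (axis j 1) x $ i)"

definition curl :: "'a metric \<Rightarrow> 'a vfield \<Rightarrow> 'a vfield" where
  "curl g X = (\<lambda>c x. sharp (g c x)
     (hodge_star2 (g c x) (ext_deriv1 (chart_image c) (\<lambda>y. flat (g c y) (X c y)) x)))"

definition cross_field :: "'a metric \<Rightarrow> 'a vfield \<Rightarrow> 'a vfield \<Rightarrow> 'a vfield" where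
  "cross_field g X Y = (\<lambda>c x. cross (g c x) (X c x) (Y c x))"

section \<open>Levi-Civita connection, Killing fields, sectional curvature\<close>

text \<open>
  Koszul formula for the constant-coefficient coordinate fields \<open>u\<close>, \<open>v\<close>, \<open>w\<close>, whose Lie
  brackets vanish: \<open>2 g(\<nabla>\<^sub>u v, w) = u g(v, w) + v g(u, w) - w g(u, v)\<close>.
\<close>
definition christoffel ::
  "(real^3) set \<Rightarrow> (real^3 \<Rightarrow> real^3^3) \<Rightarrow> real^3 \<Rightarrow> real^3 \<Rightarrow> real^3 \<Rightarrow> real^3" where
  "christoffel S G x u v = sharp (G x) (\<chi> k. let w = axis k 1 in
     1/2 * (dir_deriv S (\<lambda>y. ip (G y) v w) u x + dir_deriv S (\<lambda>y. ip (G y) u w) v x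
            - dir_deriv S (\<lambda>y. ip (G y) u v) w x))"

definition cov_deriv ::
  "(real^3) set \<Rightarrow> (real^3 \<Rightarrow> real^3^3) \<Rightarrow> real^3 \<Rightarrow> (real^3 \<Rightarrow> real^3) \<Rightarrow> real^3 \<Rightarrow> real^3" where
  "cov_deriv S G u X x = dir_deriv S X u x + christoffel S G x u (X x)"

text \<open>Killing equations \<open>\<nabla>\<^sub>i X\<^sub>j + \<nabla>\<^sub>j X\<^sub>i = 0\<close>, contracted with arbitrary vectors.\<close>
definition Killing :: "'a chart set \<Rightarrow> 'a metric \<Rightarrow> 'a vfield \<Rightarrow> bool" where
  "Killing A g X \<longleftrightarrow> (\<forall>c\<in>A. \<forall>x\<in>chart_image c. \<forall>u v.
     ip (g c x) (cov_deriv (chart_image c) (g c) u (X c) x) v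
     + ip (g c x) u (cov_deriv (chart_image c) (g c) v (X c) x) = 0)"

text \<open>
  \<open>R(u, v) w = \<nabla>\<^sub>u \<nabla>\<^sub>v w - \<nabla>\<^sub>v \<nabla>\<^sub>u w - \<nabla>\<^bsub>[u,v]\<^esub> w\<close>, where tangent vectors at \<open>x\<close> are extended to
  constant-coefficient coordinate fields, so that \<open>[u, v] = 0\<close>.
\<close>
definition Riemann ::
  "(real^3) set \<Rightarrow> (real^3 \<Rightarrow> real^3^3) \<Rightarrow> real^3 \<Rightarrow> real^3 \<Rightarrow> real^3 \<Rightarrow> real^3 \<Rightarrow> real^3" where
  "Riemann S G x u v w =
     cov_deriv S G u (cov_deriv S G v (\<lambda>_. w)) x - cov_deriv S G v (cov_deriv S G u (\<lambda>_. w)) x"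

text \<open>Sectional curvature of the plane spanned by linearly independent \<open>u\<close> and \<open>v\<close>.\<close>
definition sectional ::
  "(real^3) set \<Rightarrow> (real^3 \<Rightarrow> real^3^3) \<Rightarrow> real^3 \<Rightarrow> real^3 \<Rightarrow> real^3 \<Rightarrow> real" where
  "sectional S G x u v =
     ip (G x) (Riemann S G x u v v) u
     / (ip (G x) u u * ip (G x) v v - (ip (G x) u v)\<^sup>2)"

definition constant_sectional_curvature :: "'a chart set \<Rightarrow> 'a metric \<Rightarrow> real \<Rightarrow> bool" where
  "constant_sectional_curvature A g \<kappa> \<longleftrightarrow>
     (\<forall>c\<in>A. \<forall>x\<in>chart_image c. \<forall>u v. u \<noteq> v \<and> independent {u, v} \<longrightarrow>
        sectional (chart_image c) (g c) x u v = \<kappa>)"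

end

theory Submission
  imports Defs
begin

text \<open>
  Write \<open>k = l / 2\<close>. A Killing field \<open>X\<close> with \<open>curl X = l X\<close> satisfies the first-order equation
  \<open>\<nabla>\<^sub>u X = k X \<times> u\<close>: its covariant derivative is antisymmetric, so half the exterior derivative of the
  dual 1-form, and the curl equation identifies this with a multiple of the volume form contracted
  with \<open>X\<close> (\<open>curl_eigenfield_imp_Killing_Beltrami\<close>). The equation is linear in \<open>X\<close>, so linear
  combinations \<open>a Y\<^sub>1 + b Y\<^sub>2\<close> with constant coefficients satisfy it as well. It has two consequences.

  First, all inner products \<open>g(Y\<^sub>i, Y\<^sub>j)\<close> have zero derivative, since \<open>vol(Y\<^sub>i, u, Y\<^sub>j)\<close> is antisymmetric
  in \<open>i\<close> and \<open>j\<close>. Hence the Gram determinant of \<open>Y\<^sub>1, Y\<^sub>2\<close> is locally constant, and by connectedness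
  constant (\<open>locally_constant_imp_constant\<close>). Being nonzero at \<open>p\<close>, it is nonzero everywhere:
  \<open>Y\<^sub>1\<close> and \<open>Y\<^sub>2\<close> are linearly independent at every point.

  Second, differentiating the consequences \<open>g(\<nabla>\<^sub>u X, u) = 0\<close> and \<open>g(\<nabla>\<^sub>u X, X) = 0\<close> once more gives
  \<open>g(R(u, X) X, u) = |\<nabla>\<^sub>u X|\<^sup>2 = k\<^sup>2 (|X|\<^sup>2 |u|\<^sup>2 - g(X, u)\<^sup>2)\<close> (\<open>Riemann_Killing_Beltrami\<close>), so every plane
  that contains a nonzero value of \<open>X\<close> has sectional curvature \<open>k\<^sup>2\<close>. In dimension three every
  tangent plane meets the span of \<open>Y\<^sub>1\<close> and \<open>Y\<^sub>2\<close>, hence contains a nonzero value of some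
  \<open>a Y\<^sub>1 + b Y\<^sub>2\<close> (\<open>sectional_Killing_Beltrami\<close>).

  At boundary points, derivatives are taken within a relatively open subset of the closed
  half-space. There the curvature identities rest on \<open>smooth_on_second_order\<close>, which provides the
  symmetry of second derivatives.
\<close>

section \<open>Symmetry of second derivatives\<close>

text \<open>
  Schwarz's argument: two applications of the mean value theorem, first in direction \<open>u\<close> and then
  in direction \<open>v\<close>, turn the second difference over \<open>t\<^sup>2\<close> into a second derivative at a point that
  tends to \<open>x\<close>. The second difference is symmetric in \<open>u\<close> and \<open>v\<close>, so the order of differentiation
  does not matter.
\<close>
lemma second_difference_limit:
  fixes f :: "'a::real_normed_vector \<Rightarrow> real"
  assumes U: "open U" "x \<in> U"
    and f: "\<And>y. y \<in> U \<Longrightarrow> (f has_derivative f' y) (at y)"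
    and f': "\<And>y. y \<in> U \<Longrightarrow> ((\<lambda>z. f' z u) has_derivative f'' y) (at y)"
    and cont: "isCont (\<lambda>y. f'' y v) x"
  shows "((\<lambda>t. (f (x + t *\<^sub>R u + t *\<^sub>R v) - f (x + t *\<^sub>R u) - f (x + t *\<^sub>R v) + f x) / t\<^sup>2)
    \<longlongrightarrow> f'' x v) (at_right 0)"
proof (rule tendstoI)
  fix e :: real assume "e > 0"
  obtain d1 where d1: "d1 > 0" "ball x d1 \<subseteq> U"
    using U open_contains_ball by blast
  obtain d2 where d2: "d2 > 0" "\<And>y. dist y x < d2 \<Longrightarrow> dist (f'' y v) (f'' x v) < e"
    using cont \<open>e > 0\<close> unfolding continuous_at_eps_delta by blast
  define d where "d = min d1 d2"
  \<comment> \<open>For parameters below \<open>d / c\<close> the parallelogram spanned at \<open>x\<close> stays in the ball of radius \<open>d\<close>.\<close>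
  define c where "c = norm u + norm v + 1"
  have c: "c > 0" and d: "d > 0"
    using d1 d2 by (auto simp: c_def d_def intro: add_nonneg_pos)
  have near: "dist (x + s *\<^sub>R u + r *\<^sub>R v) x < d"
    if "0 \<le> s" "s \<le> t" "0 \<le> r" "r \<le> t" "t < d / c" for s r t
  proof -
    have "norm (s *\<^sub>R u + r *\<^sub>R v) \<le> s * norm u + r * norm v"
      using norm_triangle_ineq[of "s *\<^sub>R u" "r *\<^sub>R v"] that by simp
    also have "\<dots> \<le> t * norm u + t * norm v"
      using that by (intro add_mono mult_right_mono) auto
    also have "\<dots> \<le> t * c"
      using that by (simp add: c_def algebra_simps)
    also have "\<dots> < d"
      using that c by (simp add: field_simps)
    finally show ?thesis
      by (simp add: dist_norm add.assoc)
  qed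
  then have inU: "x + s *\<^sub>R u + r *\<^sub>R v \<in> U"
    if "0 \<le> s" "s \<le> t" "0 \<le> r" "r \<le> t" "t < d / c" for s r t
    using d1 that by (force simp: d_def dist_commute)
  have "dist ((f (x + t *\<^sub>R u + t *\<^sub>R v) - f (x + t *\<^sub>R u) - f (x + t *\<^sub>R v) + f x) / t\<^sup>2)
    (f'' x v) < e" if t: "0 < t" "t < d / c" for t
  proof -
    define \<phi> where "\<phi> s = f (x + s *\<^sub>R u + t *\<^sub>R v) - f (x + s *\<^sub>R u)" for s
    have line: "((\<lambda>s. x + s *\<^sub>R u + w) has_derivative (\<lambda>h. h *\<^sub>R u)) (at s within T)" for s T w
      by (auto intro!: derivative_eq_intros)
    have line': "((\<lambda>s. x + s *\<^sub>R u) has_derivative (\<lambda>h. h *\<^sub>R u)) (at s within T)" for s T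
      by (auto intro!: derivative_eq_intros)
    have "(\<phi> has_derivative (\<lambda>h. f' (x + s *\<^sub>R u + t *\<^sub>R v) (h *\<^sub>R u) - f' (x + s *\<^sub>R u) (h *\<^sub>R u)))
        (at s within {0..t})" if "0 \<le> s" "s \<le> t" for s
      unfolding \<phi>_def
      using has_derivative_compose[OF line f[OF inU[of s t t]]]
        has_derivative_compose[OF line' f[OF inU[of s t 0, simplified]]] that t
      by (intro has_derivative_diff) auto
    from mvt_simple[OF t(1) this] obtain s where s: "s \<in> {0<..<t}"
      and "\<phi> t - \<phi> 0 = f' (x + s *\<^sub>R u + t *\<^sub>R v) ((t - 0) *\<^sub>R u) - f' (x + s *\<^sub>R u) ((t - 0) *\<^sub>R u)"
      by blast
    moreover have "linear (f' y)" if "y \<in> U" for y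
      using f[OF that] by (rule has_derivative_linear)
    ultimately have 1: "\<phi> t - \<phi> 0 = t * (f' (x + s *\<^sub>R u + t *\<^sub>R v) u - f' (x + s *\<^sub>R u) u)"
      using inU[of s t t] inU[of s t 0] t by (auto simp: linear_cmul algebra_simps)
    have line2: "((\<lambda>r. x + s *\<^sub>R u + r *\<^sub>R v) has_derivative (\<lambda>h. h *\<^sub>R v)) (at r within T)" for r T
      by (auto intro!: derivative_eq_intros)
    have "((\<lambda>r. f' (x + s *\<^sub>R u + r *\<^sub>R v) u) has_derivative
        (\<lambda>h. f'' (x + s *\<^sub>R u + r *\<^sub>R v) (h *\<^sub>R v))) (at r within {0..t})"
      if "0 \<le> r" "r \<le> t" for r
      using has_derivative_compose[OF line2 f'[OF inU[of s t r]]] that t s by auto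
    from mvt_simple[OF t(1) this] obtain r where r: "r \<in> {0<..<t}"
      and 2: "f' (x + s *\<^sub>R u + t *\<^sub>R v) u - f' (x + s *\<^sub>R u) u
        = f'' (x + s *\<^sub>R u + r *\<^sub>R v) (t *\<^sub>R v)" by auto
    have "linear (f'' (x + s *\<^sub>R u + r *\<^sub>R v))"
      using f'[OF inU[of s t r]] s r t by (auto intro: has_derivative_linear)
    then have "\<phi> t - \<phi> 0 = t * (t * f'' (x + s *\<^sub>R u + r *\<^sub>R v) v)"
      unfolding 1 2 by (simp add: linear_cmul)
    then have "(f (x + t *\<^sub>R u + t *\<^sub>R v) - f (x + t *\<^sub>R u) - f (x + t *\<^sub>R v) + f x) / t\<^sup>2
       = f'' (x + s *\<^sub>R u + r *\<^sub>R v) v"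
      using t by (simp add: \<phi>_def power2_eq_square field_simps)
    moreover have "dist (x + s *\<^sub>R u + r *\<^sub>R v) x < d2"
      using near[of s t r] s r t by (simp add: d_def)
    ultimately show ?thesis
      using d2(2) by simp
  qed
  then show "\<forall>\<^sub>F t in at_right 0. dist ((f (x + t *\<^sub>R u + t *\<^sub>R v) - f (x + t *\<^sub>R u)
      - f (x + t *\<^sub>R v) + f x) / t\<^sup>2) (f'' x v) < e"
    using c d unfolding eventually_at_right_field by (intro exI[of _ "d / c"]) auto
qed

lemma second_derivative_symmetric:
  fixes f :: "'a::real_normed_vector \<Rightarrow> 'b::euclidean_space"
  assumes U: "open U" "x \<in> U"
    and f: "\<And>y. y \<in> U \<Longrightarrow> (f has_derivative f' y) (at y)"
    and u: "\<And>y. y \<in> U \<Longrightarrow> ((\<lambda>z. f' z u) has_derivative fu y) (at y)" "isCont (\<lambda>y. fu y v) x"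
    and v: "\<And>y. y \<in> U \<Longrightarrow> ((\<lambda>z. f' z v) has_derivative fv y) (at y)" "isCont (\<lambda>y. fv y u) x"
  shows "fu x v = fv x u"
proof (rule euclidean_eqI)
  fix b :: 'b
  let ?q = "\<lambda>t. (f (x + t *\<^sub>R u + t *\<^sub>R v) \<bullet> b - f (x + t *\<^sub>R u) \<bullet> b - f (x + t *\<^sub>R v) \<bullet> b + f x \<bullet> b) / t\<^sup>2"
  have "(?q \<longlongrightarrow> fu x v \<bullet> b) (at_right 0)"
    by (rule second_difference_limit[OF U, of "\<lambda>x. f x \<bullet> b" "\<lambda>y h. f' y h \<bullet> b" u "\<lambda>y h. fu y h \<bullet> b" v])
       (auto intro!: has_derivative_inner_left f u continuous_intros)
  moreover have "(?q \<longlongrightarrow> fv x u \<bullet> b) (at_right 0)"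
  proof -
    have "((\<lambda>t. (f (x + t *\<^sub>R v + t *\<^sub>R u) \<bullet> b - f (x + t *\<^sub>R v) \<bullet> b - f (x + t *\<^sub>R u) \<bullet> b + f x \<bullet> b) / t\<^sup>2)
      \<longlongrightarrow> fv x u \<bullet> b) (at_right 0)"
      by (rule second_difference_limit[OF U, of "\<lambda>x. f x \<bullet> b" "\<lambda>y h. f' y h \<bullet> b" v "\<lambda>y h. fv y h \<bullet> b" u])
         (auto intro!: has_derivative_inner_left f v continuous_intros)
    then show ?thesis
      by (simp add: algebra_simps)
  qed
  ultimately show "fu x v \<bullet> b = fv x u \<bullet> b"
    by (rule tendsto_unique[rotated]) simp
qed

section \<open>Smooth maps on relatively open subsets of the half-space\<close>

abbreviation open_in_half_space :: "(real^3) set \<Rightarrow> bool" where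
  "open_in_half_space S \<equiv> openin (top_of_set half_space) S"

text \<open>
  Also at a boundary point there is room to move a little in every positive coordinate direction,
  and this determines the derivative.
\<close>
lemma frechet_derivative_within_eq:
  fixes f :: "real^3 \<Rightarrow> 'b::real_normed_vector"
  assumes S: "open_in_half_space S" and x: "x \<in> S" and f: "(f has_derivative f') (at x within S)"
  shows "frechet_derivative f (at x within S) = f'"
proof (rule frechet_derivative_unique_within[OF _ f])
  show "(f has_derivative frechet_derivative f (at x within S)) (at x within S)"
    using f differentiable_def frechet_derivative_works by blast
next
  fix i :: "real^3" and e :: real
  assume i: "i \<in> Basis" and e: "e > 0"
  obtain T where T: "open T" "S = half_space \<inter> T"
    using S openin_open by blast
  then obtain r where r: "r > 0" "ball x r \<subseteq> T"
    using x open_contains_ball by blast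
  define d where "d = min e r / 2"
  have "d > 0" "d < e" "d < r"
    using e r by (auto simp: d_def)
  moreover have "x + d *\<^sub>R i \<in> half_space"
    using i x T \<open>d > 0\<close> by (auto simp: half_space_def Basis_vec_def axis_def)
  moreover have "x + d *\<^sub>R i \<in> ball x r"
    using i \<open>d > 0\<close> \<open>d < r\<close> by (simp add: dist_norm)
  ultimately show "\<exists>d. 0 < \<bar>d\<bar> \<and> \<bar>d\<bar> < e \<and> x + d *\<^sub>R i \<in> S"
    using T r by (intro exI[of _ d]) auto
qed

lemma dir_deriv_eq:
  fixes f :: "real^3 \<Rightarrow> 'b::real_normed_vector"
  assumes "open_in_half_space S" "x \<in> S" "(f has_derivative f') (at x within S)"
  shows "dir_deriv S f u x = f' u"
  using frechet_derivative_within_eq[OF assms] by (simp add: dir_deriv_def)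

lemma has_derivative_dir_deriv:
  assumes "f differentiable (at x within S)"
  shows "(f has_derivative (\<lambda>u. dir_deriv S f u x)) (at x within S)"
  using assms by (simp add: dir_deriv_def frechet_derivative_works)

lemma dir_deriv_cong:
  assumes "\<And>y. y \<in> S \<Longrightarrow> f y = g y" "x \<in> S"
  shows "dir_deriv S f u x = dir_deriv S g u x"
proof -
  have "(f has_derivative D) (at x within S) \<longleftrightarrow> (g has_derivative D) (at x within S)" for D
    using assms by (metis has_derivative_transform)
  then show ?thesis
    by (simp add: dir_deriv_def frechet_derivative_def)
qed

text \<open>
  Derivatives within \<open>S\<close> agree with those of a local smooth extension to an open set, by uniqueness.
  This transfers the symmetry of second derivatives to boundary points.
\<close>
lemma smooth_on_second_order:
  fixes f :: "real^3 \<Rightarrow> 'b::euclidean_space"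
  assumes S: "open_in_half_space S" and f: "smooth_on S f" and x: "x \<in> S"
  shows smooth_on_differentiable: "f differentiable (at x within S)"
    and smooth_on_differentiable_dir_deriv: "(\<lambda>y. dir_deriv S f u y) differentiable (at x within S)"
    and smooth_on_dir_deriv_commute:
      "dir_deriv S (\<lambda>y. dir_deriv S f v y) u x = dir_deriv S (\<lambda>y. dir_deriv S f u y) v x"
proof -
  obtain U F where U: "open U" "x \<in> U" and Ck: "\<And>k. Ck_on_open k U F"
    and eq: "\<And>y. y \<in> S \<inter> U \<Longrightarrow> F y = f y"
    using bspec[OF f[unfolded smooth_on_def] x] by (elim exE conjE) (rule that, assumption, assumption, blast+)
  define F' where "F' = (\<lambda>y. frechet_derivative F (at y))"
  define F'' where "F'' = (\<lambda>w y. frechet_derivative (\<lambda>z. F' z w) (at y))"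
  have F': "(F has_derivative F' y) (at y)" if "y \<in> U" for y
    using Ck[of "Suc 0"] that by (simp add: F'_def frechet_derivative_works)
  have F'': "((\<lambda>z. F' z w) has_derivative F'' w y) (at y)" if "y \<in> U" for y w
    using Ck[of 2] that by (simp add: F'_def F''_def frechet_derivative_works numeral_2_eq_2)
  have cont: "isCont (\<lambda>y. F'' w y z) x" for w z
    using Ck[of 2] U by (auto simp: F'_def F''_def numeral_2_eq_2 continuous_on_eq_continuous_at)
  obtain e where e: "e > 0" "ball x e \<subseteq> U"
    using U open_contains_ball by blast
  have f': "(f has_derivative F' y) (at y within S)" if "y \<in> S \<inter> U" for y
  proof -
    from that have "y \<in> U" by simp
    then obtain r where r: "r > 0" "ball y r \<subseteq> U"
      by (rule openE[OF U(1)])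
    have "F z = f z" if "z \<in> S" "dist z y < r" for z
      using that r by (intro eq) (auto simp: dist_commute)
    then show ?thesis
      using that r(1) by (intro has_derivative_transform_within[OF has_derivative_at_withinI[OF F']]) auto
  qed
  then have dir: "dir_deriv S f w y = F' y w" if "y \<in> S \<inter> U" for y w
    using dir_deriv_eq[OF S] that by blast
  have "F' z w = dir_deriv S f w z" if "z \<in> S" "dist z x < e" for z w
    using that e by (intro dir[symmetric]) (auto simp: dist_commute)
  then have f'': "((\<lambda>y. dir_deriv S f w y) has_derivative F'' w x) (at x within S)" for w
    using x e(1) U(2)
    by (intro has_derivative_transform_within[OF has_derivative_at_withinI[OF F'']]) auto
  show "f differentiable (at x within S)"
    using f' U x differentiable_def by blast
  show "(\<lambda>y. dir_deriv S f u y) differentiable (at x within S)"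
    using f'' differentiable_def by blast
  have "F'' v x u = F'' u x v"
    by (rule second_derivative_symmetric[OF U F' F'' cont F'' cont])
  then show "dir_deriv S (\<lambda>y. dir_deriv S f v y) u x = dir_deriv S (\<lambda>y. dir_deriv S f u y) v x"
    using dir_deriv_eq[OF S x f''] by simp
qed

section \<open>Linear algebra of an inner product on \<open>real^3\<close>\<close>

lemma ip_simps [simp]:
  "ip G (u + v) w = ip G u w + ip G v w" "ip G w (u + v) = ip G w u + ip G w v"
  "ip G (u - v) w = ip G u w - ip G v w" "ip G w (u - v) = ip G w u - ip G w v"
  "ip G (a *\<^sub>R u) w = a * ip G u w" "ip G w (a *\<^sub>R u) = a * ip G w u"
  "ip G (- u) w = - ip G u w" "ip G w (- u) = - ip G w u"
  "ip G 0 w = 0" "ip G w 0 = 0"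
  by (simp_all add: ip_def inner_simps linear_add linear_diff linear_scale linear_neg)

lemma ip_matrix_simps:
  "ip (A + B) u v = ip A u v + ip B u v" "ip (a *\<^sub>R A) u v = a * ip A u v"
  by (simp_all add: ip_def matrix_vector_mult_add_rdistrib inner_simps scaleR_matrix_vector_assoc[symmetric])

definition pos_def :: "real^3^3 \<Rightarrow> bool" where
  "pos_def G \<longleftrightarrow> (\<forall>u v. ip G u v = ip G v u) \<and> (\<forall>u. u \<noteq> 0 \<longrightarrow> ip G u u > 0)"

definition gram_det :: "real^3^3 \<Rightarrow> real^3 \<Rightarrow> real^3 \<Rightarrow> real" where
  "gram_det G u v = ip G u u * ip G v v - (ip G u v)\<^sup>2"

lemma pos_def_sym: "pos_def G \<Longrightarrow> ip G u v = ip G v u"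
  by (simp add: pos_def_def)

lemma pos_def_transpose:
  assumes "pos_def G"
  shows "transpose G = G"
proof -
  have "flat G u = G *v u" for u
    using pos_def_sym[OF assms, of u]
    by (simp add: flat_def vec_eq_iff) (simp add: ip_def inner_axis')
  then show ?thesis
    by (simp add: flat_eq matrix_eq)
qed

lemma pos_def_flat: "pos_def G \<Longrightarrow> flat G u = G *v u"
  by (simp add: flat_eq pos_def_transpose)

lemma pos_def_eqI:
  assumes "pos_def G" "\<And>w. ip G u w = ip G v w"
  shows "u = v"
proof (rule ccontr)
  assume "u \<noteq> v"
  then have "ip G (u - v) (u - v) > 0"
    using assms(1) by (simp add: pos_def_def del: ip_simps)
  then show False
    using assms(2)[of "u - v"] ip_simps(3)[of G u v "u - v"] by simp
qed

lemma ip_sharp: "pos_def G \<Longrightarrow> ip G (sharp G \<omega>) w = \<omega> \<bullet> w"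
  by (simp add: ip_flat flat_sharp pos_def_def)

text \<open>
  The vector \<open>N u v\<close> is \<open>sqrt (det G)\<close> times the metric cross product of \<open>u\<close> and \<open>v\<close>, in a form that
  is polynomial in \<open>G\<close>. The first identity is the transformation rule of the Euclidean cross product
  under \<open>G\<close>, the second one is the Binet-Cauchy identity.
\<close>
lemma det_mult_gram_det:
  fixes G :: "real^3^3"
  assumes G: "pos_def G"
  defines "N \<equiv> \<lambda>u v. cross3 (G *v u) (G *v v)"
  shows mult_cross_eq: "G *v N u v = det G *\<^sub>R cross3 u v"
    and gram_det_eq_dot: "gram_det G u v = N u v \<bullet> cross3 u v"
    and det_mult_gram_det_eq: "det G * gram_det G u v = ip G (N u v) (N u v)"
proof -
  show 1: "G *v N u v = det G *\<^sub>R cross3 u v"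
    using cross_matrix_mult[of G u v] by (simp add: N_def pos_def_transpose[OF G])
  have "cross3 a b \<bullet> cross3 c d = (a \<bullet> c) * (b \<bullet> d) - (a \<bullet> d) * (b \<bullet> c)" for a b c d :: "real^3"
    by (simp add: cross3_simps)
  moreover have "(G *v a) \<bullet> b = ip G a b" for a b
    using pos_def_sym[OF G, of a b] by (simp add: ip_def inner_commute)
  ultimately show 2: "gram_det G u v = N u v \<bullet> cross3 u v"
    using pos_def_sym[OF G, of u v] by (simp add: N_def gram_det_def power2_eq_square)
  show "det G * gram_det G u v = ip G (N u v) (N u v)"
    by (simp add: ip_def 1 2)
qed

lemma gram_det_nonneg:
  assumes G: "pos_def G"
  shows "gram_det G u v \<ge> 0"
proof (cases "u = 0")
  case False
  define w where "w = ip G u u *\<^sub>R v - ip G u v *\<^sub>R u"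
  have "ip G w w = ip G u u * gram_det G u v"
    using pos_def_sym[OF G, of v u]
    by (simp add: w_def gram_det_def algebra_simps power2_eq_square)
  moreover have "ip G w w \<ge> 0"
    using G unfolding pos_def_def by (cases "w = 0") (auto intro: less_imp_le)
  moreover have "ip G u u > 0"
    using G False by (simp add: pos_def_def)
  ultimately show ?thesis
    by (simp add: zero_le_mult_iff)
qed (simp add: gram_det_def)

text \<open>
  By \<open>det_mult_gram_det_eq\<close>, the determinant is a positive number divided by a Gram determinant,
  and the latter is nonnegative by Cauchy-Schwarz.
\<close>
lemma pos_def_det_pos:
  assumes G: "pos_def G"
  shows "det G > 0"
proof -
  let ?N = "cross3 (G *v axis 1 1) (G *v axis 2 1)"
  have "G *v u \<noteq> 0" if "u \<noteq> 0" for u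
    using G that by (auto simp: pos_def_def ip_def)
  then have "inj ((*v) G)"
    by (auto simp: linear_injective_0)
  then have "det G \<noteq> 0"
    using invertible_det_nz[of G] by (metis invertible_left_inverse matrix_left_invertible_injective)
  then have "G *v ?N \<noteq> 0"
    using mult_cross_eq[OF G, of "axis 1 1" "axis 2 1"] by (simp add: cross_basis axis_eq_0_iff)
  then have "?N \<noteq> 0"
    by force
  then have "det G * gram_det G (axis 1 1) (axis 2 1) > 0"
    using G by (simp add: det_mult_gram_det_eq pos_def_def)
  then show ?thesis
    using gram_det_nonneg[OF G, of "axis 1 1" "axis 2 1"] by (simp add: zero_less_mult_iff)
qed

lemma gram_det_pos:
  assumes G: "pos_def G" and uv: "cross3 u v \<noteq> 0"
  shows "gram_det G u v > 0"
proof -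
  let ?N = "cross3 (G *v u) (G *v v)"
  have "G *v ?N \<noteq> 0"
    using mult_cross_eq[OF G, of u v] pos_def_det_pos[OF G] uv by simp
  then have "?N \<noteq> 0"
    by force
  then have "det G * gram_det G u v > 0"
    using G by (simp add: det_mult_gram_det_eq pos_def_def)
  then show ?thesis
    using pos_def_det_pos[OF G] by (simp add: zero_less_mult_iff)
qed

lemma vol_eq: "vol G u v w = sqrt (det G) * (u \<bullet> cross3 v w)"
  by (simp add: vol_def dot_cross_det)

text \<open>
  The hypothesis says that \<open>Z\<close> is \<open>k\<close> times the metric cross product of \<open>y\<close> and \<open>u\<close>; the conclusion
  is Lagrange's identity for its length.
\<close>
lemma norm_cross_product:
  assumes G: "pos_def G" and Z: "\<And>w. ip G Z w = k * vol G y u w"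
  shows "ip G Z Z = k\<^sup>2 * gram_det G y u"
proof -
  let ?s = "sqrt (det G)" and ?N = "cross3 (G *v y) (G *v u)"
  have s: "?s > 0" "?s * ?s = det G"
    using pos_def_det_pos[OF G] by auto
  have rot: "a \<bullet> cross3 b c = cross3 a b \<bullet> c" for a b c :: "real^3"
    by (simp add: cross3_simps)
  have "ip G ((k / ?s) *\<^sub>R ?N) w = ip G Z w" for w
  proof -
    have "ip G ?N w = det G * (cross3 y u \<bullet> w)"
      unfolding pos_def_sym[OF G, of ?N] by (simp add: ip_def mult_cross_eq[OF G] inner_commute)
    then show ?thesis
      using s by (simp add: Z vol_eq rot field_simps)
  qed
  then have "Z = (k / ?s) *\<^sub>R ?N"
    using pos_def_eqI[OF G] by metis
  then have "ip G Z Z = (k / ?s)\<^sup>2 * (det G * gram_det G y u)"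
    by (simp add: det_mult_gram_det_eq[OF G] power2_eq_square)
  then show ?thesis
    using s by (simp add: power2_eq_square field_simps)
qed

text \<open>
  This inverts the Hodge star. An antisymmetric matrix \<open>B\<close> is given by a vector \<open>b\<close> with
  \<open>x \<bullet> B z = b \<bullet> (x \<times> z)\<close>; for \<open>B = G\<^sup>-\<^sup>1 \<beta> G\<^sup>-\<^sup>1\<close> the Hodge star of \<open>\<beta>\<close> is \<open>sqrt (det G) b\<close>. Writing
  \<open>\<beta> = G B G\<close> and moving both factors \<open>G\<close> through the cross product recovers \<open>\<beta>\<close> from \<open>b\<close>.
\<close>
lemma hodge_star2_eq_imp:
  assumes G: "pos_def G" and \<beta>: "\<And>i j. \<beta> $ i $ j = - \<beta> $ j $ i"
    and star: "hodge_star2 G \<beta> = l *\<^sub>R flat G y"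
  shows "\<beta> $ i $ j = l * vol G y (axis i 1) (axis j 1)"
proof -
  define H where "H = matrix_inv G"
  define B where "B = H ** \<beta> ** transpose H"
  define b :: "real^3" where "b = vector [B $ 2 $ 3, B $ 3 $ 1, B $ 1 $ 2]"
  let ?s = "sqrt (det G)"
  have s: "?s > 0" "?s * ?s = det G"
    using pos_def_det_pos[OF G] by auto
  have inv: "invertible G"
    using pos_def_det_pos[OF G] by (simp add: invertible_det_nz)
  have HG: "H ** G = mat 1" "G ** H = mat 1"
    using someI_ex[OF inv[unfolded invertible_def]] by (auto simp: H_def matrix_inv_def)
  have "transpose (G ** H) = mat 1"
    by (simp add: HG transpose_mat)
  then have TH: "transpose H ** G = mat 1"
    by (simp add: matrix_transpose_mul pos_def_transpose[OF G])
  have "transpose \<beta> $ i $ j = (- \<beta>) $ i $ j" for i j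
    using \<beta>[of j i] by (simp add: transpose_def)
  then have "transpose \<beta> = - \<beta>"
    unfolding vec_eq_iff by blast
  then have "transpose B = - B"
    unfolding B_def by (simp add: matrix_transpose_mul matrix_mul_assoc)
      (simp add: matrix_matrix_mult_def vec_eq_iff sum_negf)
  then have B: "transpose B $ i $ j = (- B) $ i $ j" for i j
    by simp
  have anti: "B $ j $ i = - B $ i $ j" for i j
    using B[of i j] by (simp add: transpose_def)
  have diag: "B $ i $ i = 0" for i
    using anti[of i i] by simp
  have form: "x \<bullet> (B *v z) = b \<bullet> cross3 x z" for x z
    using diag anti[of 2 1] anti[of 3 2] anti[of 1 3]
    by (simp add: b_def matrix_vector_mult_def cross3_simps)
  have "hodge_star2 G \<beta> = ?s *\<^sub>R b"
    using diag anti[of 2 1] anti[of 3 2] anti[of 1 3]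
    by (simp add: hodge_star2_def Let_def flip: H_def B_def)
       (simp add: b_def vol_eq cross3_simps forall_3 axis_def)
  then have b: "?s *\<^sub>R b = l *\<^sub>R (G *v y)"
    using star by (simp add: pos_def_flat[OF G])
  have "G ** B ** G = (G ** H) ** \<beta> ** (transpose H ** G)"
    by (simp add: B_def matrix_mul_assoc)
  then have "\<beta> = G ** B ** G"
    by (simp add: HG TH)
  then have "\<beta> *v z = G *v (B *v (G *v z))" for z
    by (simp add: matrix_vector_mul_assoc matrix_mul_assoc)
  then have "x \<bullet> (\<beta> *v z) = (G *v x) \<bullet> (B *v (G *v z))" for x z
    using pos_def_sym[OF G, of x] by (simp add: ip_def inner_commute)
  then have "?s * (x \<bullet> (\<beta> *v z)) = (?s *\<^sub>R b) \<bullet> cross3 (G *v x) (G *v z)" for x z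
    by (simp add: form)
  also have "\<dots> x z = l * ((G *v y) \<bullet> cross3 (G *v x) (G *v z))" for x z
    by (simp add: b)
  also have "\<dots> x z = l * (y \<bullet> (G *v cross3 (G *v x) (G *v z)))" for x z
    using pos_def_sym[OF G, of y "cross3 (G *v x) (G *v z)"] by (simp add: ip_def inner_commute)
  also have "\<dots> x z = ?s * (l * vol G y x z)" for x z
    using s by (simp add: mult_cross_eq[OF G] vol_eq)
  finally have "x \<bullet> (\<beta> *v z) = l * vol G y x z" for x z
    using s by simp
  moreover have "axis i 1 \<bullet> (\<beta> *v axis j 1) = \<beta> $ i $ j"
    by (simp add: inner_axis' matrix_vector_mul_component inner_axis)
  ultimately show ?thesis
    by metis
qed

lemma in_plane:
  fixes u v w :: "real^3"
  assumes uv: "cross3 u v \<noteq> 0" and w: "cross3 u v \<bullet> w = 0"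
  obtains a b where "w = a *\<^sub>R u + b *\<^sub>R v"
proof -
  let ?n = "cross3 u v"
  have "(?n \<bullet> ?n) *\<^sub>R w = (cross3 w v \<bullet> ?n) *\<^sub>R u + (cross3 u w \<bullet> ?n) *\<^sub>R v + (?n \<bullet> w) *\<^sub>R ?n"
    by (simp add: cross3_simps forall_3)
  then have "(?n \<bullet> ?n) *\<^sub>R w = (cross3 w v \<bullet> ?n) *\<^sub>R u + (cross3 u w \<bullet> ?n) *\<^sub>R v"
    using w by simp
  then have "w = (cross3 w v \<bullet> ?n / (?n \<bullet> ?n)) *\<^sub>R u + (cross3 u w \<bullet> ?n / (?n \<bullet> ?n)) *\<^sub>R v"
    using uv by (metis (no_types, lifting) divide_inverse_commute inner_eq_zero_iff scaleR_one
        left_inverse scaleR_add_right scaleR_scaleR)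
  then show ?thesis
    by (rule that)
qed

lemma plane_meets_plane:
  fixes u v y z :: "real^3"
  assumes uv: "cross3 u v \<noteq> 0" and yz: "cross3 y z \<noteq> 0"
  obtains a b c d where "a *\<^sub>R y + b *\<^sub>R z = c *\<^sub>R u + d *\<^sub>R v" "c \<noteq> 0 \<or> d \<noteq> 0"
proof -
  let ?n = "cross3 u v"
  \<comment> \<open>A combination of \<open>y\<close> and \<open>z\<close> orthogonal to the normal \<open>?n\<close> lies in the plane of \<open>u\<close> and \<open>v\<close>.\<close>
  obtain a b where ab: "a \<noteq> 0 \<or> b \<noteq> 0" "?n \<bullet> (a *\<^sub>R y + b *\<^sub>R z) = 0"
  proof (cases "?n \<bullet> y = 0")
    case True
    then show ?thesis by (intro that[of 1 0]) auto
  next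
    case False
    then show ?thesis by (intro that[of "- (?n \<bullet> z)" "?n \<bullet> y"]) (auto simp: inner_simps)
  qed
  obtain c d where cd: "a *\<^sub>R y + b *\<^sub>R z = c *\<^sub>R u + d *\<^sub>R v"
    using in_plane[OF uv ab(2)] by blast
  have "a *\<^sub>R y + b *\<^sub>R z \<noteq> 0"
  proof
    assume 0: "a *\<^sub>R y + b *\<^sub>R z = 0"
    have "b *\<^sub>R cross3 y z = cross3 y (a *\<^sub>R y + b *\<^sub>R z)"
      by (simp add: cross_add_right cross_mult_right)
    moreover have "a *\<^sub>R cross3 y z = cross3 (a *\<^sub>R y + b *\<^sub>R z) z"
      by (simp add: cross_add_left cross_mult_left)
    ultimately show False
      using ab(1) yz unfolding 0 by auto
  qed
  then have "c \<noteq> 0 \<or> d \<noteq> 0"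
    using cd by auto
  then show ?thesis
    using that cd by blast
qed

lemma independent_imp_cross_nonzero:
  fixes u v :: "real^3"
  assumes "u \<noteq> v" "independent {u, v}"
  shows "cross3 u v \<noteq> 0"
proof
  assume 0: "cross3 u v = 0"
  have u: "u \<noteq> 0"
    using assms(2) dependent_zero by blast
  have "(u \<bullet> u) *\<^sub>R v - (u \<bullet> v) *\<^sub>R u = - cross3 u (cross3 u v)"
    by (simp add: cross3_simps forall_3)
  then have "(u \<bullet> u) *\<^sub>R v = (u \<bullet> v) *\<^sub>R u"
    by (simp add: 0)
  then have "v = ((u \<bullet> v) / (u \<bullet> u)) *\<^sub>R u"
    using u by (metis (no_types, lifting) divide_inverse_commute inner_eq_zero_iff scaleR_one
        left_inverse scaleR_scaleR)
  then have "v \<in> span {u}"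
    by (metis span_base span_scale insertI1)
  moreover have "{u, v} - {v} = {u}"
    using assms(1) by auto
  ultimately show False
    using assms(2) unfolding dependent_def by force
qed

section \<open>Calculus within a chart\<close>

text \<open>
  The regularity that the curvature computations use, including the symmetry of second derivatives.
  Unlike \<open>smooth_on\<close>, it is phrased by derivatives within \<open>S\<close> only, which makes closure under linear
  combinations immediate.
\<close>
definition twice_differentiable_on :: "(real^3) set \<Rightarrow> (real^3 \<Rightarrow> 'b::real_normed_vector) \<Rightarrow> bool" where
  "twice_differentiable_on S f \<longleftrightarrow> (\<forall>x\<in>S. f differentiable (at x within S) \<and>
     (\<forall>u. (\<lambda>y. dir_deriv S f u y) differentiable (at x within S)) \<and>
     (\<forall>u v. dir_deriv S (\<lambda>y. dir_deriv S f v y) u x = dir_deriv S (\<lambda>y. dir_deriv S f u y) v x))"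

lemma smooth_on_imp_twice_differentiable_on:
  fixes f :: "real^3 \<Rightarrow> 'b::euclidean_space"
  assumes "open_in_half_space S" "smooth_on S f"
  shows "twice_differentiable_on S f"
  unfolding twice_differentiable_on_def using smooth_on_second_order[OF assms] by blast

lemma linear_dir_deriv:
  assumes "f differentiable (at x within S)"
  shows "linear (\<lambda>u. dir_deriv S f u x)"
  using linear_frechet_derivative[OF assms] by (simp add: dir_deriv_def)

lemma dir_deriv_lincomb:
  fixes f g :: "real^3 \<Rightarrow> 'b::real_normed_vector"
  assumes "open_in_half_space S" "x \<in> S"
    and f: "f differentiable (at x within S)" and g: "g differentiable (at x within S)"
  shows "dir_deriv S (\<lambda>y. a *\<^sub>R f y + b *\<^sub>R g y) u x = a *\<^sub>R dir_deriv S f u x + b *\<^sub>R dir_deriv S g u x"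
  by (rule dir_deriv_eq[OF assms(1,2)])
     (intro has_derivative_add has_derivative_scaleR_right has_derivative_dir_deriv f g)

lemma dir_deriv_add:
  fixes f g :: "real^3 \<Rightarrow> 'b::real_normed_vector"
  assumes "open_in_half_space S" "x \<in> S"
    and "f differentiable (at x within S)" "g differentiable (at x within S)"
  shows "dir_deriv S (\<lambda>y. f y + g y) u x = dir_deriv S f u x + dir_deriv S g u x"
  using dir_deriv_lincomb[OF assms, of 1 1] by simp

lemma dir_deriv_const:
  assumes "open_in_half_space S" "x \<in> S"
  shows "dir_deriv S (\<lambda>y. c) u x = 0"
  by (rule dir_deriv_eq[OF assms]) (rule has_derivative_const)

lemma dir_deriv_bounded_linear:
  fixes f :: "real^3 \<Rightarrow> 'b::real_normed_vector"
  assumes "open_in_half_space S" "x \<in> S"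
    and h: "bounded_linear h" and f: "f differentiable (at x within S)"
  shows "dir_deriv S (\<lambda>y. h (f y)) u x = h (dir_deriv S f u x)"
  by (rule dir_deriv_eq[OF assms(1,2)])
     (rule bounded_linear.has_derivative[OF h has_derivative_dir_deriv[OF f]])

lemma twice_differentiable_on_lincomb:
  fixes f g :: "real^3 \<Rightarrow> 'b::real_normed_vector"
  assumes S: "open_in_half_space S"
    and f: "twice_differentiable_on S f" and g: "twice_differentiable_on S g"
  shows "twice_differentiable_on S (\<lambda>y. a *\<^sub>R f y + b *\<^sub>R g y)"
proof -
  let ?h = "\<lambda>y. a *\<^sub>R f y + b *\<^sub>R g y"
  have diff: "(\<lambda>y. a *\<^sub>R p y + b *\<^sub>R q y) differentiable (at x within S)"
    if "p differentiable (at x within S)" "q differentiable (at x within S)"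
    for p q :: "real^3 \<Rightarrow> 'b" and x
    by (intro differentiable_add differentiable_scaleR differentiable_const that)
  have D: "dir_deriv S ?h u y = a *\<^sub>R dir_deriv S f u y + b *\<^sub>R dir_deriv S g u y"
    if "y \<in> S" for u y
    using that f g by (intro dir_deriv_lincomb[OF S]) (auto simp: twice_differentiable_on_def)
  have DD: "dir_deriv S (\<lambda>y. dir_deriv S ?h v y) u x =
     a *\<^sub>R dir_deriv S (\<lambda>y. dir_deriv S f v y) u x + b *\<^sub>R dir_deriv S (\<lambda>y. dir_deriv S g v y) u x"
    if x: "x \<in> S" for u v x
  proof -
    have "dir_deriv S (\<lambda>y. dir_deriv S ?h v y) u x =
        dir_deriv S (\<lambda>y. a *\<^sub>R dir_deriv S f v y + b *\<^sub>R dir_deriv S g v y) u x"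
      by (rule dir_deriv_cong[OF D x])
    also have "\<dots> = a *\<^sub>R dir_deriv S (\<lambda>y. dir_deriv S f v y) u x
        + b *\<^sub>R dir_deriv S (\<lambda>y. dir_deriv S g v y) u x"
      using x f g by (intro dir_deriv_lincomb[OF S]) (auto simp: twice_differentiable_on_def)
    finally show ?thesis .
  qed
  show ?thesis
    unfolding twice_differentiable_on_def
  proof (intro ballI conjI allI)
    fix x u v assume x: "x \<in> S"
    show "?h differentiable (at x within S)"
      using x f g by (intro diff) (auto simp: twice_differentiable_on_def)
    have "(\<lambda>y. a *\<^sub>R dir_deriv S f u y + b *\<^sub>R dir_deriv S g u y) differentiable (at x within S)"
      using x f g by (intro diff) (auto simp: twice_differentiable_on_def)
    then show "(\<lambda>y. dir_deriv S ?h u y) differentiable (at x within S)"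
      by (rule differentiable_transform_within[OF _ zero_less_one x]) (simp add: D)
    show "dir_deriv S (\<lambda>y. dir_deriv S ?h v y) u x = dir_deriv S (\<lambda>y. dir_deriv S ?h u y) v x"
      using x f g by (simp add: DD twice_differentiable_on_def)
  qed
qed

lemma differentiable_vec_lambda_iff:
  fixes f :: "real^3 \<Rightarrow> 'b::euclidean_space^'n"
  shows "f differentiable (at x within S) \<longleftrightarrow> (\<forall>i. (\<lambda>y. f y $ i) differentiable (at x within S))"
proof -
  have "f differentiable (at x within S) \<longleftrightarrow>
      (\<forall>i. \<forall>b\<in>Basis. (\<lambda>y. f y $ i \<bullet> b) differentiable (at x within S))"
    by (subst differentiable_componentwise_within) (auto simp: Basis_vec_def inner_axis)
  then show ?thesis
    by (subst differentiable_componentwise_within) simp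
qed

lemma differentiable_det:
  fixes B :: "real^3 \<Rightarrow> real^3^3"
  assumes "\<And>i j. (\<lambda>y. B y $ i $ j) differentiable (at x within S)"
  shows "(\<lambda>y. det (B y)) differentiable (at x within S)"
  unfolding det_3 by (intro differentiable_add differentiable_diff differentiable_mult assms)

text \<open>
  Cramer's rule expresses \<open>sharp\<close> by determinants of differentiable entries.
\<close>
lemma differentiable_sharp:
  fixes G :: "real^3 \<Rightarrow> real^3^3"
  assumes pd: "\<And>y. y \<in> S \<Longrightarrow> pos_def (G y)" and x: "x \<in> S"
    and G: "G differentiable (at x within S)" and \<omega>: "\<omega> differentiable (at x within S)"
  shows "(\<lambda>y. sharp (G y) (\<omega> y)) differentiable (at x within S)"
proof -
  \<comment> \<open>The matrices from the rule of Cramer for \<open>G y *v z = \<omega> y\<close>.\<close>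
  define C where "C k y = (\<chi> i j. if j = k then \<omega> y $ i else G y $ i $ j)" for k y
  have det: "det (G y) \<noteq> 0" if "y \<in> S" for y
    using pos_def_det_pos[OF pd[OF that]] by simp
  have cram: "(\<chi> k. det (C k y) / det (G y)) = sharp (G y) (\<omega> y)" if "y \<in> S" for y
  proof -
    have "G y *v sharp (G y) (\<omega> y) = \<omega> y"
      using flat_sharp[of "G y" "\<omega> y"] pd[OF that] by (simp add: pos_def_flat) (simp add: pos_def_def)
    then show ?thesis
      unfolding C_def by (rule iffD1[OF cramer[OF det[OF that]], symmetric])
  qed
  have comps: "(\<lambda>y. G y $ i $ j) differentiable (at x within S)"
    "(\<lambda>y. \<omega> y $ i) differentiable (at x within S)" for i j
    using G \<omega> by (auto simp: differentiable_vec_lambda_iff)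
  have "(\<lambda>y. C k y $ i $ j) differentiable (at x within S)" for k i j
    using comps by (cases "j = k") (simp_all add: C_def)
  then have "(\<lambda>y. \<chi> k. det (C k y) / det (G y)) differentiable (at x within S)"
    by (simp add: differentiable_vec_lambda_iff)
      (intro allI differentiable_divide differentiable_det comps det[OF x])
  then show ?thesis
    by (rule differentiable_transform_within[OF _ zero_less_one x]) (simp add: cram)
qed

lemma linear_functional_eq_inner:
  fixes f :: "real^3 \<Rightarrow> real"
  assumes "linear f"
  shows "f w = (\<chi> k. f (axis k 1)) \<bullet> w"
proof -
  have "f w = f (\<Sum>k\<in>UNIV. w $ k *\<^sub>R axis k 1)"
    using basis_expansion[of w] by (simp add: scalar_mult_eq_scaleR)
  also have "\<dots> = (\<Sum>k\<in>UNIV. w $ k * f (axis k 1))"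
    using assms by (simp add: linear_sum linear_cmul)
  finally show ?thesis
    by (simp add: inner_vec_def mult.commute)
qed

text \<open>
  The image of one chart with the metric in its coordinates.
\<close>
locale metric_chart =
  fixes S :: "(real^3) set" and G :: "real^3 \<Rightarrow> real^3^3"
  assumes open_S: "open_in_half_space S"
    and metric_C2: "twice_differentiable_on S G"
    and metric_pos_def: "\<And>x. x \<in> S \<Longrightarrow> pos_def (G x)"
begin

abbreviation "D \<equiv> dir_deriv S"
abbreviation "\<Gamma> \<equiv> christoffel S G"
abbreviation "nabla \<equiv> cov_deriv S G"
abbreviation "R \<equiv> Riemann S G"
abbreviation "diff_at x f \<equiv> f differentiable (at x within S)"

lemma metric_diff: "x \<in> S \<Longrightarrow> diff_at x G"
  and metric_diff2: "x \<in> S \<Longrightarrow> diff_at x (\<lambda>y. D G u y)"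
  and metric_DD: "x \<in> S \<Longrightarrow> D (\<lambda>y. D G v y) u x = D (\<lambda>y. D G u y) v x"
  using metric_C2 by (auto simp: twice_differentiable_on_def)

lemma ip_sym: "x \<in> S \<Longrightarrow> ip (G x) u v = ip (G x) v u"
  using metric_pos_def pos_def_sym by blast

lemma has_derivative_ip:
  assumes "(G has_derivative G') (at x within S)"
    and "(X has_derivative X') (at x within S)" "(Z has_derivative Z') (at x within S)"
  shows "((\<lambda>y. ip (G y) (X y) (Z y)) has_derivative
    (\<lambda>h. ip (G' h) (X x) (Z x) + ip (G x) (X' h) (Z x) + ip (G x) (X x) (Z' h))) (at x within S)"
proof -
  have "bilinear (\<lambda>(A::real^3^3) z. A *v z)"
    by (simp add: bilinear_def linear_iff matrix_vector_right_distrib matrix_vector_mult_scaleR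
        matrix_vector_mult_add_rdistrib scaleR_matrix_vector_assoc)
  then have "bounded_bilinear (\<lambda>(A::real^3^3) z. A *v z)"
    by (simp add: bilinear_conv_bounded_bilinear)
  from has_derivative_inner[OF assms(2) bounded_bilinear.FDERIV[OF this assms(1,3)]]
  show ?thesis
    by (simp add: ip_def inner_add_right add.assoc add.commute add.left_commute)
qed

lemma diff_ip:
  assumes "x \<in> S" "diff_at x X" "diff_at x Z"
  shows "diff_at x (\<lambda>y. ip (G y) (X y) (Z y))"
  using has_derivative_ip metric_diff[OF assms(1)] assms(2,3) unfolding differentiable_def by blast

lemma D_ip:
  assumes "x \<in> S" "diff_at x X" "diff_at x Z"
  shows "D (\<lambda>y. ip (G y) (X y) (Z y)) u x =
    ip (D G u x) (X x) (Z x) + ip (G x) (D X u x) (Z x) + ip (G x) (X x) (D Z u x)"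
  using assms metric_diff[OF assms(1)]
  by (intro dir_deriv_eq[OF open_S] has_derivative_ip has_derivative_dir_deriv)

lemma D_ip_const:
  assumes "x \<in> S"
  shows "D (\<lambda>y. ip (G y) v w) u x = ip (D G u x) v w"
  using D_ip[OF assms, of "\<lambda>_. v" "\<lambda>_. w"] by (simp add: dir_deriv_const[OF open_S assms])

lemma D_metric_sym:
  assumes "x \<in> S"
  shows "ip (D G u x) v w = ip (D G u x) w v"
  using dir_deriv_cong[of S "\<lambda>y. ip (G y) v w" "\<lambda>y. ip (G y) w v" x u] assms ip_sym
  by (simp add: D_ip_const)

lemma D_metric_linear:
  assumes "x \<in> S"
  shows "linear (\<lambda>u. ip (D G u x) v w)"
  using linear_dir_deriv[OF metric_diff[OF assms]]
  by (intro linearI) (simp_all add: linear_add[where f = "\<lambda>u. D G u x"]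
      linear_cmul[where f = "\<lambda>u. D G u x"] ip_matrix_simps)

lemma ip_christoffel:
  assumes x: "x \<in> S"
  shows "ip (G x) (\<Gamma> x u v) w =
    1/2 * (ip (D G u x) v w + ip (D G v x) u w - ip (D G w x) u v)"
proof -
  let ?f = "\<lambda>w. 1/2 * (ip (D G u x) v w + ip (D G v x) u w - ip (D G w x) u v)"
  have "linear ?f"
    by (intro linearI) (simp_all add: linear_add[OF D_metric_linear[OF x]]
        linear_cmul[OF D_metric_linear[OF x]] algebra_simps)
  moreover have "ip (G x) (\<Gamma> x u v) w = (\<chi> k. ?f (axis k 1)) \<bullet> w"
    by (simp add: christoffel_def ip_sharp[OF metric_pos_def[OF x]] D_ip_const[OF x] Let_def)
  ultimately show ?thesis
    using linear_functional_eq_inner[of ?f w] by simp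
qed

lemma christoffel_sym:
  assumes x: "x \<in> S"
  shows "\<Gamma> x u v = \<Gamma> x v u"
  by (rule pos_def_eqI[OF metric_pos_def[OF x]]) (simp add: ip_christoffel[OF x] D_metric_sym[OF x, of _ u v])

lemma christoffel_linear_right:
  assumes x: "x \<in> S"
  shows "linear (\<Gamma> x u)"
proof (rule linearI; rule pos_def_eqI[OF metric_pos_def[OF x]])
  note lin = D_metric_linear[OF x]
  show "ip (G x) (\<Gamma> x u (v + w)) z = ip (G x) (\<Gamma> x u v + \<Gamma> x u w) z" for v w z
    by (simp add: ip_christoffel[OF x] linear_add[OF lin] algebra_simps)
  show "ip (G x) (\<Gamma> x u (a *\<^sub>R v)) z = ip (G x) (a *\<^sub>R \<Gamma> x u v) z" for a v z
    by (simp add: ip_christoffel[OF x] linear_cmul[OF lin] algebra_simps)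
qed

lemma christoffel_linear_left:
  assumes x: "x \<in> S"
  shows "linear (\<lambda>u. \<Gamma> x u v)"
  using christoffel_linear_right[OF x, of v] christoffel_sym[OF x, of _ v] by simp

lemma metric_compatible:
  assumes x: "x \<in> S" and X: "diff_at x X" and Z: "diff_at x Z"
  shows "D (\<lambda>y. ip (G y) (X y) (Z y)) u x = ip (G x) (nabla u X x) (Z x) + ip (G x) (X x) (nabla u Z x)"
proof -
  have "ip (D G u x) v w = ip (G x) (\<Gamma> x u v) w + ip (G x) v (\<Gamma> x u w)" for v w
    unfolding ip_sym[OF x, of v "\<Gamma> x u w"]
    using D_metric_sym[OF x, of u w v] D_metric_sym[OF x, of v u w] D_metric_sym[OF x, of w u v]
    by (simp add: ip_christoffel[OF x] field_simps)
  then show ?thesis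
    by (simp add: D_ip[OF assms] cov_deriv_def)
qed

lemma christoffel_diff:
  assumes x: "x \<in> S"
  shows "diff_at x (\<lambda>y. \<Gamma> y u v)"
proof -
  let ?f = "\<lambda>y. \<chi> k. 1/2 * (ip (D G u y) v (axis k 1) + ip (D G v y) u (axis k 1) - ip (D G (axis k 1) y) u v)"
  have "diff_at x (\<lambda>y. ip (D G u y) v w)" for u v w
  proof -
    have "linear (\<lambda>A. ip A v w)"
      by (intro linearI) (simp_all add: ip_matrix_simps)
    then have "bounded_linear (\<lambda>A. ip A v w)"
      by (simp add: linear_conv_bounded_linear)
    then show ?thesis
      using metric_diff2[OF x, of u] bounded_linear.has_derivative
      unfolding differentiable_def by blast
  qed
  then have "diff_at x ?f"
    by (simp add: differentiable_vec_lambda_iff)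
  then have "diff_at x (\<lambda>y. sharp (G y) (?f y))"
    by (intro differentiable_sharp metric_pos_def metric_diff x)
  then show ?thesis
    by (rule differentiable_transform_within[OF _ zero_less_one x])
       (simp add: christoffel_def D_ip_const Let_def)
qed

text \<open>
  Expanding the field in the standard basis reduces the product rule for \<open>\<Gamma>\<close> applied to a field to
  differentiability of \<open>\<Gamma>\<close> on constant fields.
\<close>
lemma christoffel_field:
  assumes x: "x \<in> S" and X: "diff_at x X"
  shows diff_christoffel_field: "diff_at x (\<lambda>y. \<Gamma> y v (X y))"
    and D_christoffel_field: "D (\<lambda>y. \<Gamma> y v (X y)) u x = D (\<lambda>y. \<Gamma> y v (X x)) u x + \<Gamma> x v (D X u x)"
proof -
  have expand: "(\<Sum>k\<in>UNIV. w $ k *\<^sub>R \<Gamma> y v (axis k 1)) = \<Gamma> y v w" if "y \<in> S" for y w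
  proof -
    have "\<Gamma> y v w = \<Gamma> y v (\<Sum>k\<in>UNIV. w $ k *\<^sub>R axis k 1)"
      using basis_expansion[of w] by (simp add: scalar_mult_eq_scaleR)
    then show ?thesis
      using christoffel_linear_right[OF that] by (simp add: linear_sum linear_cmul)
  qed
  let ?d = "\<lambda>h. \<Sum>k\<in>UNIV. X x $ k *\<^sub>R D (\<lambda>y. \<Gamma> y v (axis k 1)) h x + (D X h x $ k) *\<^sub>R \<Gamma> x v (axis k 1)"
  have "((\<lambda>y. \<Sum>k\<in>UNIV. X y $ k *\<^sub>R \<Gamma> y v (axis k 1)) has_derivative ?d) (at x within S)"
    by (intro has_derivative_sum has_derivative_scaleR has_derivative_dir_deriv[OF christoffel_diff[OF x]]
        bounded_linear.has_derivative[OF bounded_linear_vec_nth has_derivative_dir_deriv[OF X]])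
  then have 1: "((\<lambda>y. \<Gamma> y v (X y)) has_derivative ?d) (at x within S)"
    by (rule has_derivative_transform_within[OF _ zero_less_one x]) (simp add: expand)
  then show "diff_at x (\<lambda>y. \<Gamma> y v (X y))"
    unfolding differentiable_def by blast
  have "((\<lambda>y. \<Sum>k\<in>UNIV. X x $ k *\<^sub>R \<Gamma> y v (axis k 1)) has_derivative
      (\<lambda>h. \<Sum>k\<in>UNIV. X x $ k *\<^sub>R D (\<lambda>y. \<Gamma> y v (axis k 1)) h x)) (at x within S)"
    by (intro has_derivative_sum has_derivative_scaleR_right has_derivative_dir_deriv[OF christoffel_diff[OF x]])
  then have 2: "((\<lambda>y. \<Gamma> y v (X x)) has_derivative
      (\<lambda>h. \<Sum>k\<in>UNIV. X x $ k *\<^sub>R D (\<lambda>y. \<Gamma> y v (axis k 1)) h x)) (at x within S)"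
    by (rule has_derivative_transform_within[OF _ zero_less_one x]) (simp add: expand)
  show "D (\<lambda>y. \<Gamma> y v (X y)) u x = D (\<lambda>y. \<Gamma> y v (X x)) u x + \<Gamma> x v (D X u x)"
    unfolding dir_deriv_eq[OF open_S x 1] dir_deriv_eq[OF open_S x 2]
    by (simp add: sum.distrib expand[OF x])
qed

lemma cov_deriv_const: "x \<in> S \<Longrightarrow> nabla u (\<lambda>_. w) x = \<Gamma> x u w"
  by (simp add: cov_deriv_def dir_deriv_const[OF open_S])

lemma cov_deriv_linear:
  assumes "x \<in> S" "diff_at x X"
  shows "linear (\<lambda>u. nabla u X x)"
  unfolding cov_deriv_def
  by (intro linear_compose_add linear_dir_deriv christoffel_linear_left assms)

lemma cov_deriv_diff:
  assumes "twice_differentiable_on S X" "x \<in> S"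
  shows "diff_at x (\<lambda>y. nabla u X y)"
  using assms unfolding cov_deriv_def
  by (intro differentiable_add diff_christoffel_field) (auto simp: twice_differentiable_on_def)

lemma cov_deriv_lincomb:
  assumes "x \<in> S" "diff_at x X" "diff_at x Z"
  shows "nabla u (\<lambda>y. a *\<^sub>R X y + b *\<^sub>R Z y) x = a *\<^sub>R nabla u X x + b *\<^sub>R nabla u Z x"
  using christoffel_linear_right[OF assms(1)]
  by (simp add: cov_deriv_def dir_deriv_lincomb[OF open_S assms] linear_add linear_cmul algebra_simps)

lemma cov_deriv_cong:
  assumes "\<And>y. y \<in> S \<Longrightarrow> X y = Z y" "x \<in> S"
  shows "nabla u X x = nabla u Z x"
  using dir_deriv_cong[OF assms] assms by (simp add: cov_deriv_def)

lemma Riemann_eq: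
  assumes "x \<in> S"
  shows "R x u v w = nabla u (\<lambda>y. \<Gamma> y v w) x - nabla v (\<lambda>y. \<Gamma> y u w) x"
  unfolding Riemann_def using cov_deriv_const assms
  by (simp add: cov_deriv_cong[of "nabla v (\<lambda>_. w)" "\<lambda>y. \<Gamma> y v w" x u for u v])

text \<open>
  The definition of \<open>Riemann\<close> uses the constant extension of a vector. For an arbitrary field the
  additional terms are \<open>D\<^sub>u D\<^sub>v X\<close> and \<open>\<Gamma>\<^sub>u D\<^sub>v X + \<Gamma>\<^sub>v D\<^sub>u X\<close>. They are symmetric in \<open>u\<close> and \<open>v\<close>, hence cancel.
\<close>
lemma Ricci_identity:
  assumes X: "twice_differentiable_on S X" and x: "x \<in> S"
  shows "nabla u (nabla v X) x - nabla v (nabla u X) x = R x u v (X x)"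
proof -
  have Xd: "diff_at x X" "\<And>u. diff_at x (\<lambda>y. D X u y)"
    using X x by (auto simp: twice_differentiable_on_def)
  have DD: "D (\<lambda>y. D X v y) u x = D (\<lambda>y. D X u y) v x"
    using X x by (auto simp: twice_differentiable_on_def)
  have "nabla u (nabla v X) x = D (\<lambda>y. D X v y) u x + \<Gamma> x v (D X u x) + \<Gamma> x u (D X v x)
      + nabla u (\<lambda>y. \<Gamma> y v (X x)) x" for u v
  proof -
    have "nabla u (nabla v X) x = D (\<lambda>y. D X v y + \<Gamma> y v (X y)) u x + \<Gamma> x u (D X v x + \<Gamma> x v (X x))"
      by (simp add: cov_deriv_def[abs_def])
    then show ?thesis
      using christoffel_linear_right[OF x, of u]
      by (simp add: dir_deriv_add[OF open_S x Xd(2) diff_christoffel_field[OF x Xd(1)]]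
          D_christoffel_field[OF x Xd(1)] linear_add) (simp add: cov_deriv_def)
  qed
  then show ?thesis
    by (simp add: Riemann_eq[OF x] DD)
qed

lemma Riemann_antisym_left:
  assumes "x \<in> S"
  shows "R x v u w = - R x u v w"
  by (simp add: Riemann_eq[OF assms])

lemma Riemann_lincomb_mid:
  assumes x: "x \<in> S"
  shows "R x u (a *\<^sub>R v + b *\<^sub>R z) w = a *\<^sub>R R x u v w + b *\<^sub>R R x u z w"
proof -
  have "\<Gamma> y (a *\<^sub>R v + b *\<^sub>R z) w = a *\<^sub>R \<Gamma> y v w + b *\<^sub>R \<Gamma> y z w" if "y \<in> S" for y
    using linear_add[OF christoffel_linear_left[OF that]] linear_cmul[OF christoffel_linear_left[OF that]]
    by simp
  from cov_deriv_cong[OF this x]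
  have "nabla u (\<lambda>y. \<Gamma> y (a *\<^sub>R v + b *\<^sub>R z) w) x = a *\<^sub>R nabla u (\<lambda>y. \<Gamma> y v w) x + b *\<^sub>R nabla u (\<lambda>y. \<Gamma> y z w) x"
    by (simp add: cov_deriv_lincomb x christoffel_diff)
  then show ?thesis
    using linear_add[OF cov_deriv_linear[OF x christoffel_diff[OF x, of u w]]]
      linear_cmul[OF cov_deriv_linear[OF x christoffel_diff[OF x, of u w]]]
    by (simp add: Riemann_eq[OF x] algebra_simps)
qed

lemma Riemann_lincomb_right:
  assumes x: "x \<in> S"
  shows "R x u v (a *\<^sub>R w + b *\<^sub>R z) = a *\<^sub>R R x u v w + b *\<^sub>R R x u v z"
proof -
  have "\<Gamma> y v (a *\<^sub>R w + b *\<^sub>R z) = a *\<^sub>R \<Gamma> y v w + b *\<^sub>R \<Gamma> y v z" if "y \<in> S" for y v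
    using christoffel_linear_right[OF that] by (simp add: linear_add linear_cmul)
  from cov_deriv_cong[OF this x]
  have "nabla u (\<lambda>y. \<Gamma> y v (a *\<^sub>R w + b *\<^sub>R z)) x = a *\<^sub>R nabla u (\<lambda>y. \<Gamma> y v w) x + b *\<^sub>R nabla u (\<lambda>y. \<Gamma> y v z) x" for u v
    by (simp add: cov_deriv_lincomb x christoffel_diff)
  then show ?thesis
    by (simp add: Riemann_eq[OF x] algebra_simps)
qed

text \<open>
  Differentiating \<open>g(w, w)\<close> twice gives \<open>2 g(\<nabla>\<^sub>u \<nabla>\<^sub>v w, w)\<close> plus a term symmetric in \<open>u\<close> and \<open>v\<close>, and
  second derivatives of \<open>g(w, w)\<close> commute.
\<close>
lemma Riemann_ip_same:
  assumes x: "x \<in> S"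
  shows "ip (G x) (R x u v w) w = 0"
proof -
  have first: "ip (D G v y) w w = 2 * ip (G y) (\<Gamma> y v w) w" if "y \<in> S" for v y
    using metric_compatible[OF that, of "\<lambda>_. w" "\<lambda>_. w" v] ip_sym[OF that, of w]
    by (simp add: D_ip_const[OF that] cov_deriv_const[OF that])
  have lin: "bounded_linear (\<lambda>A. ip A w w)"
    by (simp add: linear_conv_bounded_linear[symmetric] linear_iff ip_matrix_simps)
  have second: "ip (D (\<lambda>y. D G v y) u x) w w =
      2 * ip (G x) (nabla u (\<lambda>y. \<Gamma> y v w) x) w + 2 * ip (G x) (\<Gamma> x v w) (\<Gamma> x u w)" for u v
  proof -
    have "ip (D (\<lambda>y. D G v y) u x) w w = D (\<lambda>y. ip (D G v y) w w) u x"
      by (rule dir_deriv_bounded_linear[OF open_S x lin metric_diff2[OF x], symmetric])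
    also have "\<dots> = D (\<lambda>y. 2 * ip (G y) (\<Gamma> y v w) w) u x"
      using first x by (intro dir_deriv_cong) auto
    also have "\<dots> = 2 * D (\<lambda>y. ip (G y) (\<Gamma> y v w) w) u x"
      by (intro dir_deriv_bounded_linear[OF open_S x] bounded_linear_mult_right diff_ip x christoffel_diff) simp
    finally show ?thesis
      by (simp add: metric_compatible christoffel_diff x cov_deriv_const[OF x])
  qed
  show ?thesis
    using second[of u v] second[of v u] metric_DD[OF x, of u v] ip_sym[OF x, of "\<Gamma> x v w"]
    by (simp add: Riemann_eq[OF x])
qed

lemma Riemann_antisym_right:
  assumes x: "x \<in> S"
  shows "ip (G x) (R x u v z) w = - ip (G x) (R x u v w) z"
  using Riemann_ip_same[OF x, of u v "1 *\<^sub>R w + 1 *\<^sub>R z"] Riemann_ip_same[OF x, of u v]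
  unfolding Riemann_lincomb_right[OF x] by simp

lemma biquadratic_swap:
  assumes x: "x \<in> S"
  shows "ip (G x) (R x v u u) v = ip (G x) (R x u v v) u"
  using Riemann_antisym_right[OF x, of v u u v] by (simp add: Riemann_antisym_left[OF x, of u v])

text \<open>
  Together with \<open>biquadratic_swap\<close> this explains why the sectional curvature depends only on the
  plane: both the numerator and the Gram determinant scale by \<open>b\<^sup>2\<close>.
\<close>
lemma biquadratic_shear:
  assumes x: "x \<in> S"
  shows "ip (G x) (R x u (a *\<^sub>R u + b *\<^sub>R v) (a *\<^sub>R u + b *\<^sub>R v)) u = b\<^sup>2 * ip (G x) (R x u v v) u"
proof -
  have "R x u u w = 0" for w
    using Riemann_antisym_left[OF x, of u u w] by (simp add: eq_neg_iff_add_eq_0 flip: scaleR_2)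
  then show ?thesis
    using Riemann_ip_same[OF x, of u v u]
    by (simp add: Riemann_lincomb_mid[OF x] Riemann_lincomb_right[OF x] power2_eq_square)
qed

end

section \<open>Killing fields that are eigenfields of curl\<close>

lemma vol_swap: "vol G u w v = - vol G v w u" "vol G u v w = - vol G u w v"
  by (simp_all add: vol_eq cross3_simps)

lemma vol_refl: "vol G u v u = 0" "vol G u u v = 0" "vol G u v v = 0"
  by (simp_all add: vol_eq dot_cross_self)

lemma gram_det_shear:
  assumes "pos_def G"
  shows "gram_det G (a *\<^sub>R u + b *\<^sub>R v) u = b\<^sup>2 * gram_det G u v"
  using pos_def_sym[OF assms, of v u]
  by (simp add: gram_det_def power2_eq_square algebra_simps)

lemma gram_det_commute:
  assumes "pos_def G"
  shows "gram_det G u v = gram_det G v u"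
  using pos_def_sym[OF assms, of v u] by (simp add: gram_det_def mult.commute)

context metric_chart
begin

text \<open>
  The second condition says \<open>\<nabla>\<^sub>u X = k X \<times> u\<close>, which is equivalent to the Killing equations together with
  \<open>curl X = 2 k X\<close>. In this form it is visibly linear in \<open>X\<close>.
\<close>
definition Killing_Beltrami :: "real \<Rightarrow> (real^3 \<Rightarrow> real^3) \<Rightarrow> bool" where
  "Killing_Beltrami k X \<longleftrightarrow> twice_differentiable_on S X \<and>
     (\<forall>x\<in>S. \<forall>u w. ip (G x) (nabla u X x) w = k * vol (G x) (X x) u w)"

lemma Killing_Beltrami_diff: "Killing_Beltrami k X \<Longrightarrow> x \<in> S \<Longrightarrow> diff_at x X"
  by (simp add: Killing_Beltrami_def twice_differentiable_on_def)

lemma ip_Killing_Beltrami: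
  "Killing_Beltrami k X \<Longrightarrow> x \<in> S \<Longrightarrow> ip (G x) (nabla u X x) w = k * vol (G x) (X x) u w"
  by (simp add: Killing_Beltrami_def)

lemma Killing_Beltrami_lincomb:
  assumes X: "Killing_Beltrami k X" and Z: "Killing_Beltrami k Z"
  shows "Killing_Beltrami k (\<lambda>y. a *\<^sub>R X y + b *\<^sub>R Z y)"
  unfolding Killing_Beltrami_def
proof (intro conjI ballI allI)
  show "twice_differentiable_on S (\<lambda>y. a *\<^sub>R X y + b *\<^sub>R Z y)"
    using X Z by (intro twice_differentiable_on_lincomb open_S) (simp_all add: Killing_Beltrami_def)
  fix x u w assume x: "x \<in> S"
  show "ip (G x) (nabla u (\<lambda>y. a *\<^sub>R X y + b *\<^sub>R Z y) x) w = k * vol (G x) (a *\<^sub>R X x + b *\<^sub>R Z x) u w"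
    using X Z x by (simp add: cov_deriv_lincomb Killing_Beltrami_diff ip_Killing_Beltrami)
      (simp add: vol_eq inner_add_left algebra_simps)
qed

lemma ext_deriv1_flat:
  assumes x: "x \<in> S" and X: "diff_at x X"
  shows "ext_deriv1 S (\<lambda>y. flat (G y) (X y)) x $ i $ j =
    ip (G x) (nabla (axis i 1) X x) (axis j 1) - ip (G x) (nabla (axis j 1) X x) (axis i 1)"
proof -
  have "diff_at x (\<lambda>y. flat (G y) (X y))"
    using diff_ip[OF x X] by (simp add: differentiable_vec_lambda_iff flat_def)
  then have "dir_deriv S (\<lambda>y. flat (G y) (X y)) u x $ j = D (\<lambda>y. flat (G y) (X y) $ j) u x" for u j
    by (rule dir_deriv_bounded_linear[OF open_S x bounded_linear_vec_nth, symmetric])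
  also have "\<dots> u j = ip (G x) (nabla u X x) (axis j 1) + ip (G x) (X x) (\<Gamma> x u (axis j 1))" for u j
    using metric_compatible[OF x X, of "\<lambda>_. axis j 1"] by (simp add: flat_def cov_deriv_const[OF x])
  finally show ?thesis
    by (simp add: ext_deriv1_def christoffel_sym[OF x, of "axis j 1" "axis i 1"])
qed

text \<open>
  For a Killing field \<open>d\<omega>(u, w) = g(\<nabla>\<^sub>u X, w) - g(\<nabla>\<^sub>w X, u) = 2 g(\<nabla>\<^sub>u X, w)\<close>, and inverting the
  Hodge star in \<open>\<star>d\<omega> = l \<omega>\<close> gives \<open>d\<omega>(u, w) = l vol(X, u, w)\<close>.
\<close>
lemma curl_eigenfield_imp_Killing_Beltrami:
  assumes X: "twice_differentiable_on S X"
    and Killing: "\<And>x u v. x \<in> S \<Longrightarrow> ip (G x) (nabla u X x) v + ip (G x) u (nabla v X x) = 0"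
    and curl: "\<And>x. x \<in> S \<Longrightarrow>
      sharp (G x) (hodge_star2 (G x) (ext_deriv1 S (\<lambda>y. flat (G y) (X y)) x)) = l *\<^sub>R X x"
  shows "Killing_Beltrami (l / 2) X"
  unfolding Killing_Beltrami_def
proof (intro conjI ballI allI X)
  fix x u w assume x: "x \<in> S"
  have Xd: "diff_at x X"
    using X x by (simp add: twice_differentiable_on_def)
  let ?\<beta> = "ext_deriv1 S (\<lambda>y. flat (G y) (X y)) x"
  have "hodge_star2 (G x) ?\<beta> = flat (G x) (l *\<^sub>R X x)"
    using flat_sharp[of "G x" "hodge_star2 (G x) ?\<beta>"] metric_pos_def[OF x]
    by (simp add: curl[OF x] pos_def_def)
  also have "\<dots> = l *\<^sub>R flat (G x) (X x)"
    by (simp add: flat_def vec_eq_iff)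
  finally have \<beta>: "?\<beta> $ i $ j = l * vol (G x) (X x) (axis i 1) (axis j 1)" for i j
    by (intro hodge_star2_eq_imp metric_pos_def x) (simp_all add: ext_deriv1_def)
  have basis: "ip (G x) (nabla (axis i 1) X x) (axis j 1) = l / 2 * vol (G x) (X x) (axis i 1) (axis j 1)" for i j
    using \<beta>[of i j] Killing[OF x, of "axis i 1" "axis j 1"]
      ip_sym[OF x, of "axis i 1" "nabla (axis j 1) X x"]
    by (simp add: ext_deriv1_flat[OF x Xd])
  have "bilinear (\<lambda>u w. ip (G x) (nabla u X x) w)"
    using linear_add[OF cov_deriv_linear[OF x Xd]] linear_cmul[OF cov_deriv_linear[OF x Xd]]
    by (simp add: bilinear_def linear_iff)
  moreover have "bilinear (\<lambda>u w. l / 2 * vol (G x) (X x) u w)"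
    by (simp add: bilinear_def linear_iff vol_eq cross_add_left cross_add_right cross_mult_left
        cross_mult_right inner_add_right algebra_simps)
  ultimately have "(\<lambda>u w. ip (G x) (nabla u X x) w) = (\<lambda>u w. l / 2 * vol (G x) (X x) u w)"
    by (rule bilinear_eq_stdbasis) (auto simp: Basis_vec_def basis)
  then show "ip (G x) (nabla u X x) w = l / 2 * vol (G x) (X x) u w"
    by metis
qed

text \<open>
  The derivative of \<open>g(X, Z)\<close> in direction \<open>u\<close> is \<open>k (vol(X, u, Z) + vol(Z, u, X)) = 0\<close>.
\<close>
lemma Killing_Beltrami_ip_locally_constant:
  assumes X: "Killing_Beltrami k X" and Z: "Killing_Beltrami k Z" and x: "x \<in> S"
  obtains e where "e > 0"
    "\<And>y. y \<in> S \<inter> ball x e \<Longrightarrow> ip (G y) (X y) (Z y) = ip (G x) (X x) (Z x)"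
proof -
  let ?f = "\<lambda>y. ip (G y) (X y) (Z y)"
  have 0: "(?f has_derivative (\<lambda>h. 0)) (at y within S)" if y: "y \<in> S" for y
  proof -
    have "D ?f u y = 0" for u
      using ip_sym[OF y, of "X y"] vol_swap(1)[of "G y" "X y" u "Z y"]
      by (simp add: metric_compatible y Killing_Beltrami_diff[OF X] Killing_Beltrami_diff[OF Z]
          ip_Killing_Beltrami[OF X y] ip_Killing_Beltrami[OF Z y])
    moreover have "diff_at y ?f"
      by (intro diff_ip y Killing_Beltrami_diff[OF X] Killing_Beltrami_diff[OF Z])
    ultimately show ?thesis
      using has_derivative_dir_deriv[of ?f y S] by simp
  qed
  obtain T where T: "open T" "S = half_space \<inter> T"
    using open_S openin_open by blast
  then obtain e where e: "e > 0" "ball x e \<subseteq> T"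
    using x open_contains_ball by blast
  \<comment> \<open>Near \<open>x\<close> the set \<open>S\<close> is convex, so that a zero derivative forces constancy.\<close>
  have eq: "S \<inter> ball x e = half_space \<inter> ball x e"
    using T e by blast
  have "half_space = {y. axis 3 1 \<bullet> y \<ge> 0}"
    by (simp add: half_space_def inner_axis')
  then have "convex (S \<inter> ball x e)"
    unfolding eq using convex_halfspace_ge by (metis convex_Int convex_ball)
  moreover have "(?f has_derivative (\<lambda>h. 0)) (at y within S \<inter> ball x e)" if "y \<in> S \<inter> ball x e" for y
    using 0[of y] that by (auto intro: has_derivative_subset)
  ultimately have "?f y = ?f x" if "y \<in> S \<inter> ball x e" for y
    using that x e(1) by (intro has_derivative_zero_unique[of "S \<inter> ball x e" ?f]) auto
  then show ?thesis
    using that e(1) by blast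
qed

lemma Killing_Beltrami_gram_det_locally_constant:
  assumes X: "Killing_Beltrami k X" and Z: "Killing_Beltrami k Z" and x: "x \<in> S"
  obtains U where "openin (top_of_set S) U" "x \<in> U"
    "\<And>y. y \<in> U \<Longrightarrow> gram_det (G y) (X y) (Z y) = gram_det (G x) (X x) (Z x)"
proof -
  obtain e1 where e1: "e1 > 0" "\<And>y. y \<in> S \<inter> ball x e1 \<Longrightarrow> ip (G y) (X y) (X y) = ip (G x) (X x) (X x)"
    using Killing_Beltrami_ip_locally_constant[OF X X x] by blast
  obtain e2 where e2: "e2 > 0" "\<And>y. y \<in> S \<inter> ball x e2 \<Longrightarrow> ip (G y) (X y) (Z y) = ip (G x) (X x) (Z x)"
    using Killing_Beltrami_ip_locally_constant[OF X Z x] by blast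
  obtain e3 where e3: "e3 > 0" "\<And>y. y \<in> S \<inter> ball x e3 \<Longrightarrow> ip (G y) (Z y) (Z y) = ip (G x) (Z x) (Z x)"
    using Killing_Beltrami_ip_locally_constant[OF Z Z x] by blast
  let ?U = "S \<inter> (ball x e1 \<inter> ball x e2 \<inter> ball x e3)"
  have "openin (top_of_set S) ?U"
    by (intro openin_open_Int open_Int open_ball)
  moreover have "x \<in> ?U"
    using x e1(1) e2(1) e3(1) by simp
  moreover have "gram_det (G y) (X y) (Z y) = gram_det (G x) (X x) (Z x)" if "y \<in> ?U" for y
    using that e1(2)[of y] e2(2)[of y] e3(2)[of y] by (simp add: gram_det_def)
  ultimately show ?thesis
    using that by blast
qed

text \<open>
  The value is \<open>|\<nabla>\<^sub>u X|\<^sup>2\<close>. It is computed by differentiating the pointwise identities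
  \<open>g(\<nabla>\<^sub>u X, u) = 0\<close>, \<open>g(\<nabla>\<^sub>v X, u) + g(\<nabla>\<^sub>u X, v) = 0\<close> and \<open>g(\<nabla>\<^sub>u X, X) = 0\<close> once, where \<open>v\<close> is the
  constant extension of \<open>X x\<close>; the terms with \<open>\<nabla>\<^sub>v X\<close> itself vanish at \<open>x\<close>.
\<close>
lemma Riemann_Killing_Beltrami:
  assumes X: "Killing_Beltrami k X" and x: "x \<in> S"
  shows "ip (G x) (R x u (X x) (X x)) u = k\<^sup>2 * gram_det (G x) (X x) u"
proof -
  define v where "v = X x"
  note X2 = X[unfolded Killing_Beltrami_def, THEN conjunct1]
  note diff = cov_deriv_diff[OF X2 x] and dX = ip_Killing_Beltrami[OF X] and Xd = Killing_Beltrami_diff[OF X x]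
  note compat = metric_compatible[OF x]
  have zero: "D f w x = 0" if "\<And>y. y \<in> S \<Longrightarrow> f y = (0::real)" for f w
    using dir_deriv_cong[of S f "\<lambda>_. 0" x w] that x by (simp add: dir_deriv_const[OF open_S])
  have 1: "ip (G x) (nabla v (nabla u X) x) u + ip (G x) (nabla u X x) (\<Gamma> x v u) = 0"
    using zero[of "\<lambda>y. ip (G y) (nabla u X y) u" v] compat[OF diff[of u] differentiable_const[of u], of v]
    by (simp add: dX vol_refl cov_deriv_const[OF x])
  have "ip (G x) (nabla u (nabla v X) x) u + ip (G x) (nabla v X x) (\<Gamma> x u u)
      + (ip (G x) (nabla u (nabla u X) x) v + ip (G x) (nabla u X x) (\<Gamma> x u v)) = 0"
  proof -
    have "D (\<lambda>y. ip (G y) (nabla v X y) u + ip (G y) (nabla u X y) v) u x = 0"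
      by (intro zero) (simp add: dX vol_swap(2)[where v = v and w = u])
    then show ?thesis
      using compat[OF diff[of v] differentiable_const[of u], of u]
        compat[OF diff[of u] differentiable_const[of v], of u]
      by (simp add: dir_deriv_add[OF open_S x] diff_ip[OF x diff] cov_deriv_const[OF x])
  qed
  moreover have "ip (G x) (nabla v X x) w = 0" for w
    by (simp add: dX x v_def vol_refl)
  ultimately have 2: "ip (G x) (nabla u (nabla v X) x) u
      + ip (G x) (nabla u (nabla u X) x) v + ip (G x) (nabla u X x) (\<Gamma> x u v) = 0"
    by simp
  have 3: "ip (G x) (nabla u (nabla u X) x) v + ip (G x) (nabla u X x) (nabla u X x) = 0"
    using zero[of "\<lambda>y. ip (G y) (nabla u X y) (X y)" u] compat[OF diff[of u] Xd, of u]
    by (simp add: dX vol_refl v_def)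
  have "R x u v v = nabla u (nabla v X) x - nabla v (nabla u X) x"
    using Ricci_identity[OF X2 x, of u v] by (simp add: v_def)
  then have "ip (G x) (R x u v v) u = ip (G x) (nabla u X x) (nabla u X x)"
    using 1 2 3 christoffel_sym[OF x, of u v] by simp
  also have "\<dots> = k\<^sup>2 * gram_det (G x) v u"
    by (intro norm_cross_product metric_pos_def x) (simp add: dX x v_def)
  finally show ?thesis
    by (simp add: v_def)
qed

text \<open>
  The given plane meets the span of \<open>X x\<close> and \<open>Z x\<close> in a line, spanned by the value of some linear
  combination of \<open>X\<close> and \<open>Z\<close>. That combination is again a Killing-Beltrami field, so
  \<open>Riemann_Killing_Beltrami\<close> gives the curvature of the plane.
\<close>
lemma sectional_Killing_Beltrami:
  assumes X: "Killing_Beltrami k X" and Z: "Killing_Beltrami k Z" and x: "x \<in> S"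
    and XZ: "gram_det (G x) (X x) (Z x) \<noteq> 0"
    and uv: "u \<noteq> v" "independent {u, v}"
  shows "sectional S G x u v = k\<^sup>2"
proof -
  note pd = metric_pos_def[OF x]
  have cross: "cross3 u v \<noteq> 0"
    using uv by (rule independent_imp_cross_nonzero)
  have "cross3 (X x) (Z x) \<noteq> 0"
    using XZ by (auto simp: gram_det_eq_dot[OF pd])
  from plane_meets_plane[OF cross this] obtain a b c d
    where W: "a *\<^sub>R X x + b *\<^sub>R Z x = c *\<^sub>R u + d *\<^sub>R v" and cd: "c \<noteq> 0 \<or> d \<noteq> 0"
    by blast
  have curv: "ip (G x) (R x w (c *\<^sub>R u + d *\<^sub>R v) (c *\<^sub>R u + d *\<^sub>R v)) w
      = k\<^sup>2 * gram_det (G x) (c *\<^sub>R u + d *\<^sub>R v) w" for w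
    using Riemann_Killing_Beltrami[OF Killing_Beltrami_lincomb[OF X Z, of a b] x, of w] unfolding W .
  have "ip (G x) (R x u v v) u = k\<^sup>2 * gram_det (G x) u v"
  proof (cases "d = 0")
    case False
    then show ?thesis
      using curv[of u] unfolding biquadratic_shear[OF x] gram_det_shear[OF pd] by simp
  next
    case True
    then show ?thesis
      using curv[of v] cd unfolding add.commute[of "c *\<^sub>R u"] biquadratic_shear[OF x] gram_det_shear[OF pd]
      by (simp add: biquadratic_swap[OF x, of u v] gram_det_commute[OF pd, of v u])
  qed
  moreover have "gram_det (G x) u v > 0"
    using gram_det_pos[OF pd cross] .
  ultimately show ?thesis
    by (simp add: sectional_def gram_det_def)
qed

end

section \<open>From charts to the manifold\<close>

context oriented_smooth_3_manifold
begin

lemma inj_chart: "c \<in> A \<Longrightarrow> inj_on (chart_map c) (chart_dom c)"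
  using homeomorphic_imp_injective_map[OF homeomorphic] open_dom openin_subset[OF open_dom]
  by (simp add: inf.absorb2)

lemma transition_chart_map:
  assumes "c \<in> A" "q \<in> chart_dom c"
  shows "transition c d (chart_map c q) = chart_map d q"
  using inj_chart[OF assms(1)] assms(2) by (simp add: transition_def)

lemma openin_chart_vimage:
  assumes c: "c \<in> A" and U: "openin (top_of_set (chart_image c)) U"
  shows "openin M {q \<in> chart_dom c. chart_map c q \<in> U}"
proof -
  have "openin (subtopology M (chart_dom c))
      {q \<in> topspace (subtopology M (chart_dom c)). chart_map c q \<in> U}"
    using openin_continuous_map_preimage[OF homeomorphic_imp_continuous_map[OF homeomorphic[OF c]] U] .
  moreover have "topspace (subtopology M (chart_dom c)) = chart_dom c"
    using openin_subset[OF open_dom[OF c]] by auto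
  ultimately show ?thesis
    using openin_trans_full[OF _ open_dom[OF c]] by metis
qed

text \<open>
  The function \<open>h\<close> lives on chart images; by \<open>compat\<close> it descends to the manifold.
\<close>
lemma locally_constant_imp_constant:
  assumes conn: "connected_space M"
    and compat: "\<And>c d q. c \<in> A \<Longrightarrow> d \<in> A \<Longrightarrow> q \<in> chart_dom c \<Longrightarrow> q \<in> chart_dom d \<Longrightarrow>
      h c (chart_map c q) = h d (chart_map d q)"
    and loc: "\<And>c x. c \<in> A \<Longrightarrow> x \<in> chart_image c \<Longrightarrow>
      \<exists>U. openin (top_of_set (chart_image c)) U \<and> x \<in> U \<and> (\<forall>y\<in>U. h c y = h c x)"
    and c: "c \<in> A" "p \<in> chart_dom c" and d: "d \<in> A" "q \<in> chart_dom d"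
  shows "h d (chart_map d q) = h c (chart_map c p)"
proof (rule ccontr)
  assume neq: "h d (chart_map d q) \<noteq> h c (chart_map c p)"
  \<comment> \<open>Both \<open>h = h(p)\<close> and \<open>h \<noteq> h(p)\<close> are open conditions, because \<open>h\<close> is locally constant.\<close>
  define W where "W Q = {r. \<exists>e\<in>A. r \<in> chart_dom e \<and> Q (h e (chart_map e r))}" for Q
  have W_open: "openin M (W Q)" for Q
  proof (subst openin_subopen, intro ballI)
    fix r assume "r \<in> W Q"
    then obtain e where e: "e \<in> A" "r \<in> chart_dom e" "Q (h e (chart_map e r))"
      by (auto simp: W_def)
    then have "chart_map e r \<in> chart_image e"
      by (simp add: chart_image_def)
    from loc[OF e(1) this] obtain U where U: "openin (top_of_set (chart_image e)) U"
      "chart_map e r \<in> U" "\<forall>y\<in>U. h e y = h e (chart_map e r)"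
      by blast
    let ?V = "{s \<in> chart_dom e. chart_map e s \<in> U}"
    have "?V \<subseteq> W Q"
    proof
      fix s assume "s \<in> ?V"
      then show "s \<in> W Q"
        using e U(3) unfolding W_def by auto
    qed
    then show "\<exists>T. openin M T \<and> r \<in> T \<and> T \<subseteq> W Q"
      using openin_chart_vimage[OF e(1) U(1)] e(2) U(2) by (intro exI[of _ ?V]) simp
  qed
  let ?a = "h c (chart_map c p)"
  have "topspace M \<subseteq> W (\<lambda>t. t = ?a) \<union> W (\<lambda>t. t \<noteq> ?a)"
    unfolding cover[symmetric] W_def by blast
  moreover have "W (\<lambda>t. t = ?a) \<inter> W (\<lambda>t. t \<noteq> ?a) = {}"
  proof -
    have False if "e1 \<in> A" "r \<in> chart_dom e1" "h e1 (chart_map e1 r) = ?a"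
      "e2 \<in> A" "r \<in> chart_dom e2" "h e2 (chart_map e2 r) \<noteq> ?a" for e1 e2 r
      using compat[OF that(1,4,2,5)] that(3,6) by simp
    then show ?thesis
      unfolding W_def by blast
  qed
  moreover have "p \<in> W (\<lambda>t. t = ?a)" "q \<in> W (\<lambda>t. t \<noteq> ?a)"
    using c d neq unfolding W_def by blast+
  ultimately show False
    using conn W_open unfolding connected_space_def by (metis empty_iff)
qed

end

context oriented_Riemannian_3_manifold
begin

lemma metric_chart: "c \<in> A \<Longrightarrow> metric_chart (chart_image c) (g c)"
  using open_image smooth_metric metric_sym metric_pos
  by unfold_locales (auto simp: pos_def_def intro: smooth_on_imp_twice_differentiable_on)

lemma gram_det_chart_independent:
  assumes X: "smooth_vector_field A X" and Z: "smooth_vector_field A Z"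
    and cd: "c \<in> A" "d \<in> A" and q: "q \<in> chart_dom c" "q \<in> chart_dom d"
  shows "gram_det (g c (chart_map c q)) (X c (chart_map c q)) (Z c (chart_map c q)) =
    gram_det (g d (chart_map d q)) (X d (chart_map d q)) (Z d (chart_map d q))"
proof -
  let ?x = "chart_map c q"
  have x: "?x \<in> overlap c d"
    using q by (simp add: overlap_def)
  have "X d (transition c d ?x) = transition_deriv c d ?x (X c ?x)"
    "Z d (transition c d ?x) = transition_deriv c d ?x (Z c ?x)"
    using X Z cd x by (auto simp: smooth_vector_field_def)
  then show ?thesis
    using metric_transform[OF cd x] transition_chart_map[OF cd(1) q(1), of d]
    by (simp add: gram_det_def)
qed

lemma Killing_Beltrami_in_chart:
  assumes X: "smooth_vector_field A X" and K: "Killing A g X"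
    and curl: "vfield_eq A (curl g X) (\<lambda>c x. l *\<^sub>R X c x)" and c: "c \<in> A"
  shows "metric_chart.Killing_Beltrami (chart_image c) (g c) (l / 2) (X c)"
proof (rule metric_chart.curl_eigenfield_imp_Killing_Beltrami[OF metric_chart[OF c]])
  show "twice_differentiable_on (chart_image c) (X c)"
    using X c open_image by (auto simp: smooth_vector_field_def intro: smooth_on_imp_twice_differentiable_on)
  show "ip (g c x) (cov_deriv (chart_image c) (g c) u (X c) x) v
      + ip (g c x) u (cov_deriv (chart_image c) (g c) v (X c) x) = 0" if "x \<in> chart_image c" for x u v
    using K c that by (simp add: Killing_def)
  show "sharp (g c x) (hodge_star2 (g c x) (ext_deriv1 (chart_image c) (\<lambda>y. flat (g c y) (X c y)) x))
      = l *\<^sub>R X c x" if "x \<in> chart_image c" for x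
    using curl c that by (simp add: vfield_eq_def curl_def)
qed

end

lemma cross_nonzero_imp_gram_det_pos:
  assumes G: "pos_def G" and "cross G u v \<noteq> 0"
  shows "gram_det G u v > 0"
proof (rule gram_det_pos[OF G], rule notI)
  assume "cross3 u v = 0"
  moreover have "vol G u v w = sqrt (det G) * (cross3 u v \<bullet> w)" for w
    by (simp add: vol_eq) (simp add: cross3_simps)
  ultimately have "vol G u v w = 0" for w
    by simp
  then have "(\<chi> k. vol G u v (axis k 1)) = 0"
    by (simp add: vec_eq_iff)
  then have "cross G u v = sharp G 0"
    by (simp add: cross_def)
  moreover have "sharp G 0 = 0"
    by (rule pos_def_eqI[OF G]) (simp add: ip_sharp[OF G])
  ultimately show False
    using assms(2) by simp
qed

theorem theoremA2:
  fixes M :: "'a topology" and A :: "'a chart set" and g :: "'a metric"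
    and Y1 Y2 :: "'a vfield" and l :: real and p :: 'a
  assumes "oriented_Riemannian_3_manifold M A g"
    and "connected_space M"
    and "smooth_vector_field A Y1" and "smooth_vector_field A Y2"
    and "Killing A g Y1" and "Killing A g Y2"
    and "vfield_eq A (curl g Y1) (\<lambda>c x. l *\<^sub>R Y1 c x)"
    and "vfield_eq A (curl g Y2) (\<lambda>c x. l *\<^sub>R Y2 c x)"
    and "p \<in> topspace M"
    and "\<not> zero_at A (cross_field g Y1 Y2) p"
  shows "constant_sectional_curvature A g (l\<^sup>2 / 4)"
proof -
  interpret oriented_Riemannian_3_manifold M A g
    by fact
  define h where "h c x = gram_det (g c x) (Y1 c x) (Y2 c x)" for c x
  note beltrami1 = Killing_Beltrami_in_chart[OF assms(3,5,7)]
  note beltrami2 = Killing_Beltrami_in_chart[OF assms(4,6,8)]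
  obtain c0 where c0: "c0 \<in> A" "p \<in> chart_dom c0"
    and "cross (g c0 (chart_map c0 p)) (Y1 c0 (chart_map c0 p)) (Y2 c0 (chart_map c0 p)) \<noteq> 0"
    using assms(10) by (auto simp: zero_at_def cross_field_def)
  moreover have "pos_def (g c0 (chart_map c0 p))"
    using metric_chart.metric_pos_def[OF metric_chart[OF c0(1)]] c0(2) by (simp add: chart_image_def)
  ultimately have h0: "h c0 (chart_map c0 p) > 0"
    unfolding h_def by (intro cross_nonzero_imp_gram_det_pos)
  have loc: "\<exists>U. openin (top_of_set (chart_image c)) U \<and> x \<in> U \<and> (\<forall>y\<in>U. h c y = h c x)"
    if "c \<in> A" "x \<in> chart_image c" for c x
    using metric_chart.Killing_Beltrami_gram_det_locally_constant[OF metric_chart beltrami1 beltrami2] that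
    unfolding h_def by metis
  have h: "h c x \<noteq> 0" if c: "c \<in> A" and x: "x \<in> chart_image c" for c x
  proof -
    obtain q where q: "q \<in> chart_dom c" "x = chart_map c q"
      using x by (auto simp: chart_image_def)
    have "h c (chart_map c q) = h c0 (chart_map c0 p)"
      using gram_det_chart_independent[OF assms(3,4)] unfolding h_def[symmetric]
      by (rule locally_constant_imp_constant[OF assms(2) _ loc c0 c q(1)])
    then show ?thesis
      using h0 q(2) by simp
  qed
  have "sectional (chart_image c) (g c) x u v = (l / 2)\<^sup>2"
    if "c \<in> A" "x \<in> chart_image c" "u \<noteq> v" "independent {u, v}" for c x u v
    using metric_chart.sectional_Killing_Beltrami[OF metric_chart beltrami1 beltrami2] that h[unfolded h_def] by blast
  then show ?thesis
    by (simp add: constant_sectional_curvature_def power_divide)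
qed

end
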